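(* There exist figure eight knots $K_1$ and $K_2$ in $S^3$ and a trefoil $T$ in the mutual complement $\overline{S^3\backslash(V(K_1)\cup V(K_2))}$ such that there is no ambient isotopy $H:S^3\times I\to S^3$ taking $K_1$ to $K_2$ having the property that $H_t|_{V(T)}=\mathrm{id}_{V(T)}$ for all $t\in I$.
   Context: Knots are smooth embeddings of $S^1$ in $S^3$ and ambient isotopies are smooth; $I=[0,1]$; $V(\cdot)$ denotes a closed regular neighborhood of a knot, with $V(T)$ disjoint from $K_1$ and $K_2$. A figure eight knot (trefoil) means any knot in $S^3$ ambient isotopic to the standard figure eight knot (to a trefoil knot). *)

theory Defs
  imports "HOL-Analysis.Analysis"
begin

text \<open>
  The three-sphere is the unit sphere of \<open>\<complex> \<times> \<complex>\<close>, whose product norm is the Euclidean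
  norm of \<open>\<real>\<^sup>4\<close>; the circle and the closed disc lie in \<open>\<complex>\<close>.
\<close>

abbreviation S1 :: "complex set" where "S1 \<equiv> sphere 0 1"

abbreviation D2 :: "complex set" where "D2 \<equiv> cball 0 1"

abbreviation S3 :: "(complex \<times> complex) set" where "S3 \<equiv> sphere 0 1"

text \<open>
  \<open>Ck_on k U f\<close> is meant for open \<open>U\<close>: all iterated directional derivatives of order at most
  \<open>k\<close> exist (as values of total derivatives) and are continuous on \<open>U\<close>.
\<close>

primrec Ck_on ::
  "nat \<Rightarrow> 'a::euclidean_space set \<Rightarrow> ('a \<Rightarrow> 'b::euclidean_space) \<Rightarrow> bool" where
  "Ck_on 0 U f \<longleftrightarrow> continuous_on U f"
| "Ck_on (Suc k) U f \<longleftrightarrow>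
     (\<forall>x\<in>U. f differentiable (at x)) \<and> (\<forall>v. Ck_on k U (\<lambda>x. frechet_derivative f (at x) v))"

text \<open>
  On an arbitrary subset of a Euclidean space, smooth means locally extendable to a smooth map
  on an open set. For embedded submanifolds such as \<open>S3\<close>, \<open>S3 \<times> {0..1}\<close> and \<open>S1 \<times> D2\<close> this
  is smoothness in the sense of manifolds (with boundary).
\<close>

definition smooth_on ::
  "'a::euclidean_space set \<Rightarrow> ('a \<Rightarrow> 'b::euclidean_space) \<Rightarrow> bool" where
  "smooth_on A f \<longleftrightarrow>
     (\<forall>x\<in>A. \<exists>U g. open U \<and> x \<in> U \<and> (\<forall>k. Ck_on k U g) \<and> (\<forall>y\<in>A \<inter> U. g y = f y))"

definition diffeomorphism ::
  "'a::euclidean_space set \<Rightarrow> 'b::euclidean_space set \<Rightarrow> ('a \<Rightarrow> 'b) \<Rightarrow> bool" where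
  "diffeomorphism A B f \<longleftrightarrow>
     bij_betw f A B \<and> smooth_on A f \<and> smooth_on B (inv_into A f)"

text \<open>
  As \<open>S1\<close> is compact, a smooth embedding is the same as an injective smooth immersion; the
  immersion condition is read off in the angular coordinate. The knot as a subset of \<open>S3\<close> is
  \<open>K ` S1\<close>; values of \<open>K\<close> off \<open>S1\<close> are irrelevant.
\<close>

definition knot :: "(complex \<Rightarrow> complex \<times> complex) \<Rightarrow> bool" where
  "knot K \<longleftrightarrow>
     smooth_on S1 K \<and> K ` S1 \<subseteq> S3 \<and> inj_on K S1 \<and>
     (\<forall>t::real. vector_derivative (\<lambda>s. K (cis s)) (at t) \<noteq> 0)"

definition ambient_isotopy :: "((complex \<times> complex) \<times> real \<Rightarrow> complex \<times> complex) \<Rightarrow> bool" where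
  "ambient_isotopy H \<longleftrightarrow>
     smooth_on (S3 \<times> {0..1}) H \<and>
     (\<forall>t\<in>{0..1}. diffeomorphism S3 S3 (\<lambda>x. H (x, t))) \<and>
     (\<forall>x\<in>S3. H (x, 0) = x)"

text \<open>Knots are compared as unoriented subsets of \<open>S3\<close>, not as parametrized curves.\<close>

definition takes_knot ::
  "((complex \<times> complex) \<times> real \<Rightarrow> complex \<times> complex) \<Rightarrow>
   (complex \<Rightarrow> complex \<times> complex) \<Rightarrow> (complex \<Rightarrow> complex \<times> complex) \<Rightarrow> bool" where
  "takes_knot H K K' \<longleftrightarrow> (\<lambda>x. H (x, 1)) ` (K ` S1) = K' ` S1"

definition ambient_isotopic ::
  "(complex \<Rightarrow> complex \<times> complex) \<Rightarrow> (complex \<Rightarrow> complex \<times> complex) \<Rightarrow> bool" where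
  "ambient_isotopic K K' \<longleftrightarrow> (\<exists>H. ambient_isotopy H \<and> takes_knot H K K')"

text \<open>
  A closed regular neighborhood of a smooth knot is a closed tubular neighborhood: the image of
  a smooth embedding of the solid torus \<open>S1 \<times> D2\<close> whose core is the knot. The differential is
  taken in the coordinates \<open>(t, w)\<close> with \<open>z = cis t\<close>, one-sidedly at the boundary of \<open>D2\<close>.
\<close>

definition closed_regular_neighborhood ::
  "(complex \<Rightarrow> complex \<times> complex) \<Rightarrow> (complex \<times> complex) set \<Rightarrow> bool" where
  "closed_regular_neighborhood K V \<longleftrightarrow>
     (\<exists>\<phi> :: complex \<times> complex \<Rightarrow> complex \<times> complex.
        smooth_on (S1 \<times> D2) \<phi> \<and> inj_on \<phi> (S1 \<times> D2) \<and>
        (\<forall>t::real. \<forall>w\<in>D2. \<exists>D.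
           ((\<lambda>(s, v). \<phi> (cis s, v)) has_derivative D) (at (t, w) within UNIV \<times> D2) \<and> inj D) \<and>
        (\<forall>z\<in>S1. \<phi> (z, 0) = K z) \<and>
        \<phi> ` (S1 \<times> D2) = V \<and> V \<subseteq> S3)"

text \<open>Inverse stereographic projection \<open>\<complex> \<times> \<real> = \<real>\<^sup>3 \<rightarrow> S\<^sup>3\<close>.\<close>

definition inv_stereographic :: "complex \<times> real \<Rightarrow> complex \<times> complex" where
  "inv_stereographic p =
     (let c = fst p; h = snd p; r = (norm c)\<^sup>2 + h\<^sup>2
      in (2 * c / of_real (r + 1), Complex (2 * h / (r + 1)) ((r - 1) / (r + 1))))"

text \<open>
  With \<open>z = cis t\<close>, this is the usual parametrization
  \<open>((2 + cos 2t) cos 3t, (2 + cos 2t) sin 3t, sin 4t)\<close> of the figure eight knot in \<open>\<real>\<^sup>3\<close>,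
  carried to the sphere.
\<close>

definition standard_figure_eight :: "complex \<Rightarrow> complex \<times> complex" where
  "standard_figure_eight z = inv_stereographic (of_real (2 + Re (z ^ 2)) * z ^ 3, Im (z ^ 4))"

text \<open>The \<open>(2, 3)\<close> torus knot and its mirror image: the two trefoils.\<close>

definition standard_trefoil :: "complex \<Rightarrow> complex \<times> complex" where
  "standard_trefoil z = (z ^ 2 / of_real (sqrt 2), z ^ 3 / of_real (sqrt 2))"

definition mirror_trefoil :: "complex \<Rightarrow> complex \<times> complex" where
  "mirror_trefoil z = (z ^ 2 / of_real (sqrt 2), cnj z ^ 3 / of_real (sqrt 2))"

definition figure_eight_knot :: "(complex \<Rightarrow> complex \<times> complex) \<Rightarrow> bool" where
  "figure_eight_knot K \<longleftrightarrow> knot K \<and> ambient_isotopic K standard_figure_eight"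

definition trefoil_knot :: "(complex \<Rightarrow> complex \<times> complex) \<Rightarrow> bool" where
  "trefoil_knot K \<longleftrightarrow>
     knot K \<and> (ambient_isotopic K standard_trefoil \<or> ambient_isotopic K mirror_trefoil)"

end

theory Submission
  imports Defs
begin

text \<open>
  The polynomial \<open>f(a, b) = sqrt 2 * a ^ 3 - b ^ 2\<close> vanishes on the sphere exactly on the standard
  trefoil, and an isotopy that fixes the trefoil keeps every other point off it. So whether \<open>f\<close> has
  a continuous logarithm on a knot (whether the linking number with the trefoil is zero) does not
  change under such an isotopy. Two conformal dilations of the standard figure eight knot are told
  apart in this way: the very small one lies near \<open>(0, - \<i>)\<close>, where \<open>f\<close> is close to \<open>1\<close>; the other
  one lies in the region where \<open>sqrt 2 * a ^ 3\<close> dominates \<open>f\<close>, so that \<open>f\<close> winds nine times around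
  \<open>0\<close> along it.
\<close>

section \<open>Calculus of smooth maps\<close>

text \<open>Dilations of three-space, extended to the sphere, are joined to the identity by
  dilations, so every rescaled copy of the standard knot is a figure eight knot by an explicit
  isotopy. The factor 1 / sqrt 2 of the linked copy comes from this picture: under stereographic
  projection the region where \<open>a\<close> has modulus at least 1 / sqrt 2, bounded by the torus
  that carries the trefoil, is the solid torus of tube radius 1 around a horizontal circle of radius
  sqrt 2. The standard figure eight knot stays within 5/4 of the circle of radius 2. Scaled by 1 /
  sqrt 2 it lies inside that solid torus, and 5 / (4 sqrt 2) < 1 leaves room for tubes around both
  curves. There it is a closed braid of three strands: \<open>a\<close> is a positive multiple of
  \<open>z ^ 3\<close>, whence the nine turns of \<open>a ^ 3\<close>. Logarithms suit the task
  because having one means being null-homotopic in the punctured plane, a property of the knot as a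
  set and not of its parametrization.\<close>

lemma Ck_on_cong:
  assumes "open U" "\<And>x. x \<in> U \<Longrightarrow> f x = g x"
  shows "Ck_on k U f \<longleftrightarrow> Ck_on k U g"
  using assms(2)
proof (induction k arbitrary: f g)
  case 0
  then show ?case by (simp cong: continuous_on_cong)
next
  case (Suc k)
  have d: "(f has_derivative D) (at x) \<longleftrightarrow> (g has_derivative D) (at x)" if "x \<in> U" for x D
    using has_derivative_transform_within_open[OF _ assms(1) that] Suc.prems by metis
  have "Ck_on k U (\<lambda>x. frechet_derivative f (at x) v) \<longleftrightarrow> Ck_on k U (\<lambda>x. frechet_derivative g (at x) v)" for v
    by (rule Suc.IH) (simp add: frechet_derivative_def d)
  then show ?case
    by (simp add: differentiable_def d)
qed

lemma Ck_on_SucD: "Ck_on (Suc k) U f \<Longrightarrow> Ck_on k U f"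
proof (induction k arbitrary: f)
  case 0
  then show ?case
    by (auto intro!: differentiable_imp_continuous_on differentiable_at_imp_differentiable_on)
next
  case (Suc k)
  then show ?case by (metis Ck_on.simps(2))
qed

text \<open>Replaces the derivative chosen by \<open>frechet_derivative\<close> with any explicit
  formula for it, so that each closure property below is an induction on the order driven by one
  differentiation rule.\<close>

lemma Ck_on_SucI:
  assumes "open U" "\<And>x. x \<in> U \<Longrightarrow> (f has_derivative f' x) (at x)"
    and "\<And>v. Ck_on k U (\<lambda>x. f' x v)"
  shows "Ck_on (Suc k) U f"
proof -
  have "Ck_on k U (\<lambda>x. frechet_derivative f (at x) v) \<longleftrightarrow> Ck_on k U (\<lambda>x. f' x v)" for v
    using assms(1) frechet_derivative_at[OF assms(2)] by (intro Ck_on_cong) auto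
  then show ?thesis
    using assms by (auto simp: differentiable_def)
qed

lemma Ck_on_Suc_has_derivative:
  "Ck_on (Suc k) U f \<Longrightarrow> x \<in> U \<Longrightarrow> (f has_derivative frechet_derivative f (at x)) (at x)"
  by (simp add: frechet_derivative_works)

lemma Ck_on_const: "open U \<Longrightarrow> Ck_on k U (\<lambda>x. c)"
  by (induction k arbitrary: c) (auto intro!: Ck_on_SucI has_derivative_const simp del: Ck_on.simps(2))

lemma Ck_on_ident: "open U \<Longrightarrow> Ck_on k U (\<lambda>x. x)"
  by (cases k)
    (auto intro!: Ck_on_SucI has_derivative_ident Ck_on_const simp del: Ck_on.simps(2))

lemma Ck_on_bounded_linear:
  assumes "open U" "bounded_linear L"
  shows "Ck_on k U f \<Longrightarrow> Ck_on k U (\<lambda>x. L (f x))"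
proof (induction k arbitrary: f)
  case 0
  then show ?case using assms by (simp add: bounded_linear.continuous_on)
next
  case (Suc k)
  have "((\<lambda>x. L (f x)) has_derivative (\<lambda>v. L (frechet_derivative f (at x) v))) (at x)" if "x \<in> U" for x
    using bounded_linear.has_derivative[OF assms(2) Ck_on_Suc_has_derivative[OF Suc.prems that]] .
  then show ?case
    using Suc by (intro Ck_on_SucI[OF assms(1)]) auto
qed

lemma Ck_on_add:
  assumes "open U"
  shows "Ck_on k U f \<Longrightarrow> Ck_on k U g \<Longrightarrow> Ck_on k U (\<lambda>x. f x + g x)"
proof (induction k arbitrary: f g)
  case 0
  then show ?case by (simp add: continuous_on_add)
next
  case (Suc k)
  then show ?case
    by (intro Ck_on_SucI[OF assms has_derivative_add[OF Ck_on_Suc_has_derivative Ck_on_Suc_has_derivative]])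
      auto
qed

text \<open>The product rule yields a sum of two terms of the same bilinear shape, with one factor
  differentiated in each; hence the induction ranges over all pairs \<open>f\<close>,
  \<open>g\<close>.\<close>

lemma Ck_on_bounded_bilinear:
  assumes "open U" "bounded_bilinear B"
  shows "Ck_on k U f \<Longrightarrow> Ck_on k U g \<Longrightarrow> Ck_on k U (\<lambda>x. B (f x) (g x))"
proof (induction k arbitrary: f g)
  case 0
  then show ?case using assms by (simp add: bounded_bilinear.continuous_on)
next
  case (Suc k)
  note fg = Ck_on_SucD[OF Suc.prems(1)] Ck_on_SucD[OF Suc.prems(2)]
  show ?case
    by (rule Ck_on_SucI[OF assms(1) bounded_bilinear.FDERIV[OF assms(2)
          Ck_on_Suc_has_derivative[OF Suc.prems(1)] Ck_on_Suc_has_derivative[OF Suc.prems(2)]]])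
      (use Suc fg in \<open>auto intro!: Ck_on_add assms\<close>)
qed

lemma Ck_on_Pair:
  assumes "open U"
  shows "Ck_on k U f \<Longrightarrow> Ck_on k U g \<Longrightarrow> Ck_on k U (\<lambda>x. (f x, g x))"
proof (induction k arbitrary: f g)
  case 0
  then show ?case by (simp add: continuous_on_Pair)
next
  case (Suc k)
  then show ?case
    by (intro Ck_on_SucI[OF assms has_derivative_Pair[OF Ck_on_Suc_has_derivative Ck_on_Suc_has_derivative]])
      auto
qed

lemmas Ck_on_mult = Ck_on_bounded_bilinear[OF _ bounded_bilinear_mult]
lemmas Ck_on_scaleR = Ck_on_bounded_bilinear[OF _ bounded_bilinear_scaleR]
lemmas Ck_on_uminus = Ck_on_bounded_linear[OF _ bounded_linear_minus[OF bounded_linear_ident]]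
lemmas Ck_on_Re = Ck_on_bounded_linear[OF _ bounded_linear_Re]
lemmas Ck_on_Im = Ck_on_bounded_linear[OF _ bounded_linear_Im]
lemmas Ck_on_fst = Ck_on_bounded_linear[OF _ bounded_linear_fst]
lemmas Ck_on_snd = Ck_on_bounded_linear[OF _ bounded_linear_snd]
lemmas Ck_on_of_real = Ck_on_bounded_linear[OF _ bounded_linear_of_real]

lemma Ck_on_diff:
  "open U \<Longrightarrow> Ck_on k U f \<Longrightarrow> Ck_on k U g \<Longrightarrow> Ck_on k U (\<lambda>x. f x - g x)"
  using Ck_on_add[of U k f "\<lambda>x. - g x"] Ck_on_uminus[of U k g] by simp

lemma Ck_on_power:
  fixes f :: "_ \<Rightarrow> _::{real_normed_algebra_1, euclidean_space}"
  shows "open U \<Longrightarrow> Ck_on k U f \<Longrightarrow> Ck_on k U (\<lambda>x. f x ^ n)"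
  by (induction n) (simp_all add: Ck_on_const Ck_on_mult)

text \<open>The derivative is a product of the derivative of \<open>f\<close> with two copies of
  \<open>inverse (f x)\<close>, the very function of the induction hypothesis, so \<open>f\<close>
  stays fixed.\<close>

lemma Ck_on_inverse:
  fixes f :: "_ \<Rightarrow> _::{real_normed_div_algebra, euclidean_space}"
  assumes "open U" "\<And>x. x \<in> U \<Longrightarrow> f x \<noteq> 0"
  shows "Ck_on k U f \<Longrightarrow> Ck_on k U (\<lambda>x. inverse (f x))"
proof (induction k)
  case 0
  then show ?case using assms by (simp add: continuous_on_inverse)
next
  case (Suc k)
  note f = Ck_on_SucD[OF Suc.prems(1)]
  show ?case
    by (rule Ck_on_SucI[OF assms(1) Deriv.has_derivative_inverse[OF assms(2) Ck_on_Suc_has_derivative[OF Suc.prems]]])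
      (use Suc f in \<open>auto intro!: Ck_on_uminus Ck_on_mult assms\<close>)
qed

lemma Ck_on_divide:
  fixes f :: "_ \<Rightarrow> _::{real_normed_field, euclidean_space}"
  assumes "open U" "\<And>x. x \<in> U \<Longrightarrow> g x \<noteq> 0"
  shows "Ck_on k U f \<Longrightarrow> Ck_on k U g \<Longrightarrow> Ck_on k U (\<lambda>x. f x / g x)"
  unfolding divide_inverse using assms by (intro Ck_on_mult Ck_on_inverse) auto

lemma Ck_on_exp:
  fixes f :: "_ \<Rightarrow> complex"
  assumes "open U"
  shows "Ck_on k U f \<Longrightarrow> Ck_on k U (\<lambda>x. exp (f x))"
proof (induction k)
  case 0
  then show ?case using assms by (simp add: continuous_on_exp)
next
  case (Suc k)
  note f = Ck_on_SucD[OF Suc.prems(1)]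
  have exp: "((\<lambda>x. exp (f x)) has_derivative (\<lambda>v. exp (f x) * frechet_derivative f (at x) v)) (at x)"
    if "x \<in> U" for x
    by (rule has_derivative_compose[OF Ck_on_Suc_has_derivative[OF Suc.prems that]
          DERIV_exp[unfolded has_field_derivative_def]])
  then show ?case
    using Suc f by (intro Ck_on_SucI[OF assms(1) exp]) (auto intro!: Ck_on_mult assms)
qed

lemma Ck_on_Complex:
  assumes "open U"
  shows "Ck_on k U f \<Longrightarrow> Ck_on k U g \<Longrightarrow> Ck_on k U (\<lambda>x. Complex (f x) (g x))"
  unfolding Complex_eq using assms
  by (intro Ck_on_add Ck_on_mult Ck_on_of_real Ck_on_const)

lemmas Ck_on_intros = Ck_on_const Ck_on_ident Ck_on_add Ck_on_diff Ck_on_uminus Ck_on_mult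
  Ck_on_scaleR Ck_on_power Ck_on_divide Ck_on_exp Ck_on_Re Ck_on_Im Ck_on_fst Ck_on_snd
  Ck_on_of_real Ck_on_Pair Ck_on_Complex

section \<open>Smoothness on arbitrary subsets\<close>

lemma smooth_onI:
  assumes "open U" "A \<subseteq> U" "\<And>k. Ck_on k U f"
  shows "smooth_on A f"
  unfolding smooth_on_def using assms by blast

lemma smooth_on_cong: "(\<And>x. x \<in> A \<Longrightarrow> f x = g x) \<Longrightarrow> smooth_on A f \<longleftrightarrow> smooth_on A g"
  unfolding smooth_on_def by (metis IntD1)

lemma smooth_on_imp_continuous_on:
  assumes "smooth_on A f"
  shows "continuous_on A f"
  unfolding continuous_on_eq_continuous_within
proof
  fix x assume x: "x \<in> A"
  then obtain U g where U: "open U" "x \<in> U" "Ck_on 0 U g" "\<forall>y\<in>A \<inter> U. g y = f y"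
    using assms unfolding smooth_on_def by metis
  then have "continuous (at x within A) g"
    by (simp add: continuous_on_eq_continuous_at continuous_at_imp_continuous_within)
  then show "continuous (at x within A) f"
    using U x openin_open_Int[of U A]
    by (intro continuous_transform_within_openin[of _ A g "A \<inter> U" f]) auto
qed

section \<open>Knots, dilations and stereographic projection\<close>

text \<open>Serves to restrict a tube map to its core along the linear map
  \<open>\<lambda>x. (x, 0)\<close>. For linear \<open>L\<close> the derivative in direction
  \<open>v\<close> is again a function composed with \<open>L\<close>, namely the derivative of
  \<open>f\<close> in direction \<open>L v\<close>.\<close>

lemma Ck_on_compose_linear:
  assumes "open U" "bounded_linear L"
  shows "Ck_on k U f \<Longrightarrow> Ck_on k (L -` U) (\<lambda>x. f (L x))"
proof (induction k arbitrary: f)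
  case 0
  have "continuous_on (L -` U) (f \<circ> L)"
    using 0 bounded_linear.continuous_on[OF assms(2) continuous_on_id]
    by (intro continuous_on_compose) (auto intro: continuous_on_subset)
  then show ?case by (simp add: o_def)
next
  case (Suc k)
  have W: "open (L -` U)"
    using assms by (intro open_vimage) (auto intro: bounded_linear.continuous_on continuous_on_id)
  have der: "((\<lambda>x. f (L x)) has_derivative (\<lambda>v. frechet_derivative f (at (L x)) (L v))) (at x)"
    if "x \<in> L -` U" for x
    using that by (intro has_derivative_compose[OF bounded_linear_imp_has_derivative[OF assms(2)]
          Ck_on_Suc_has_derivative[OF Suc.prems]]) simp
  show ?case
    by (rule Ck_on_SucI[OF W der]) (use Suc in auto)
qed

text \<open>The core inherits smoothness and injectivity from the tube, and its velocity is
  \<open>D (1, 0)\<close>, nonzero since \<open>D\<close> is injective. Thus only tubes have to be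
  constructed; the knots come with them.\<close>

lemma closed_regular_neighborhood_imp_knot:
  assumes "closed_regular_neighborhood K V"
  shows "knot K" and "K ` S1 \<subseteq> V"
proof -
  have "\<exists>\<phi>. smooth_on (S1 \<times> D2) \<phi> \<and> inj_on \<phi> (S1 \<times> D2) \<and>
        (\<forall>t::real. \<forall>w\<in>D2. \<exists>D.
           ((\<lambda>(s, v). \<phi> (cis s, v)) has_derivative D) (at (t, w) within UNIV \<times> D2) \<and> inj D) \<and>
        (\<forall>z\<in>S1. \<phi> (z, 0) = K z) \<and>
        \<phi> ` (S1 \<times> D2) = V \<and> V \<subseteq> S3"
    using assms unfolding closed_regular_neighborhood_def .
  then obtain \<phi> where \<phi>: "smooth_on (S1 \<times> D2) \<phi> \<and> inj_on \<phi> (S1 \<times> D2) \<and>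
        (\<forall>t::real. \<forall>w\<in>D2. \<exists>D.
           ((\<lambda>(s, v). \<phi> (cis s, v)) has_derivative D) (at (t, w) within UNIV \<times> D2) \<and> inj D) \<and>
        (\<forall>z\<in>S1. \<phi> (z, 0) = K z) \<and>
        \<phi> ` (S1 \<times> D2) = V \<and> V \<subseteq> S3" ..
  note smooth = \<phi>[THEN conjunct1]
    and inj = \<phi>[THEN conjunct2, THEN conjunct1]
    and der = \<phi>[THEN conjunct2, THEN conjunct2, THEN conjunct1]
    and core' = \<phi>[THEN conjunct2, THEN conjunct2, THEN conjunct2, THEN conjunct1]
    and V = \<phi>[THEN conjunct2, THEN conjunct2, THEN conjunct2, THEN conjunct2, THEN conjunct1]
      \<phi>[THEN conjunct2, THEN conjunct2, THEN conjunct2, THEN conjunct2, THEN conjunct2]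
  note core = core'[rule_format]
  show KV: "K ` S1 \<subseteq> V"
  proof (rule image_subsetI)
    fix z assume z: "z \<in> S1"
    have "\<phi> (z, 0) \<in> V"
      unfolding V(1)[symmetric] by (rule imageI) (use z in simp)
    then show "K z \<in> V"
      using core[OF z] by simp
  qed
  have "smooth_on S1 K"
    unfolding smooth_on_def
  proof
    fix z assume "z \<in> S1"
    then have "(z, 0) \<in> S1 \<times> D2" by simp
    then obtain U g where U: "open U" "(z, 0) \<in> U" "\<forall>k. Ck_on k U g"
        "\<forall>y\<in>(S1 \<times> D2) \<inter> U. g y = \<phi> y"
      using smooth[unfolded smooth_on_def, THEN bspec] by metis
    have L: "bounded_linear (\<lambda>x::complex. (x, 0::complex))"
      by (intro bounded_linear_Pair bounded_linear_ident bounded_linear_zero)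
    let ?W = "(\<lambda>x. (x, 0)) -` U"
    have "open ?W"
      by (intro open_vimage U continuous_intros)
    moreover have "\<forall>k. Ck_on k ?W (\<lambda>x. g (x, 0))"
      by (intro allI Ck_on_compose_linear[OF U(1) L] U(3)[rule_format])
    moreover have "\<forall>y\<in>S1 \<inter> ?W. g (y, 0) = K y"
      using U(4) core by auto
    moreover have "z \<in> ?W"
      using U(2) by simp
    ultimately show "\<exists>U g. open U \<and> z \<in> U \<and> (\<forall>k. Ck_on k U g) \<and> (\<forall>y\<in>S1 \<inter> U. g y = K y)"
      by (intro exI[of _ ?W] exI[of _ "\<lambda>x. g (x, 0)"] conjI)
  qed
  moreover have "K ` S1 \<subseteq> S3"
    using KV V by blast
  moreover have "inj_on K S1"
  proof (rule inj_onI)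
    fix x y assume "x \<in> S1" "y \<in> S1" "K x = K y"
    then show "x = y"
      using inj_onD[OF inj, of "(x, 0)" "(y, 0)"] core by auto
  qed
  moreover have "vector_derivative (\<lambda>s. K (cis s)) (at t) \<noteq> 0" for t
  proof -
    obtain D where D: "((\<lambda>(s, v). \<phi> (cis s, v)) has_derivative D) (at (t, 0) within UNIV \<times> D2)" "inj D"
      using der by (meson centre_in_cball zero_le_one)
    have lin: "linear D"
      using D(1) by (simp add: has_derivative_bounded_linear bounded_linear.linear)
    have "((\<lambda>s. (s, 0::complex)) has_derivative (\<lambda>h. (h, 0))) (at t)"
      by (auto intro!: derivative_eq_intros)
    then have "((\<lambda>s. (\<lambda>(s, v). \<phi> (cis s, v)) (s, 0)) has_derivative (\<lambda>h. D (h, 0))) (at t)"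
      by (rule has_derivative_in_compose) (rule has_derivative_subset[OF D(1)], auto)
    then have "((\<lambda>s. K (cis s)) has_derivative (\<lambda>h. D (h, 0))) (at t)"
      by (simp add: core)
    moreover have "(\<lambda>h. D (h, 0)) = (\<lambda>h. h *\<^sub>R D (1, 0))"
      using linear_cmul[OF lin, of _ "(1, 0)"]
      unfolding scaleR_Pair real_scaleR_def mult_1_right scaleR_zero_right by (rule ext)
    ultimately have "((\<lambda>s. K (cis s)) has_vector_derivative D (1, 0)) (at t)"
      unfolding has_vector_derivative_def by simp
    moreover have "D (1, 0) \<noteq> 0"
      using injD[OF D(2), of "(1, 0)" 0] linear_0[OF lin] by (auto simp: zero_prod_def)
    ultimately show ?thesis
      by (simp add: vector_derivative_at)
  qed
  ultimately show "knot K"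
    by (simp add: knot_def)
qed

text \<open>The dilation \<open>p \<mapsto> m *\<^sub>R p\<close> of \<open>\<real>\<^sup>3\<close>, transported to the sphere.\<close>

definition dilation :: "real \<Rightarrow> complex \<times> complex \<Rightarrow> complex \<times> complex" where
  "dilation m x =
     (let d = m\<^sup>2 * (1 + Im (snd x)) + (1 - Im (snd x))
      in ((2 * m / d) *\<^sub>R fst x,
          Complex (2 * m * Re (snd x) / d) ((m\<^sup>2 * (1 + Im (snd x)) - (1 - Im (snd x))) / d)))"

section \<open>The group of dilations of the sphere\<close>

lemma mem_S3: "x \<in> S3 \<longleftrightarrow> (norm (fst x))\<^sup>2 + (Re (snd x))\<^sup>2 + (Im (snd x))\<^sup>2 = 1"
proof -
  have "x \<in> S3 \<longleftrightarrow> (norm x)\<^sup>2 = 1"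
    using norm_ge_zero[of x] by (auto simp: power2_eq_1_iff simp del: norm_ge_zero)
  then show ?thesis
    by (simp only: norm_prod_def cmod_power2 real_sqrt_pow2 add_nonneg_nonneg zero_le_power2 add.assoc)
qed

declare mem_sphere [simp del] mem_sphere_0 [simp del]

text \<open>With \<open>k = Im (snd x)\<close> and \<open>p\<close> the stereographic image of
  \<open>x\<close>, the denominator is \<open>1 - k\<close> times one plus the squared norm of
  \<open>m *\<^sub>R p\<close>. Clearing the factor \<open>1 - k\<close> extends the formula to the
  pole \<open>k = 1\<close>, which the case split treats separately.\<close>

lemma dilation_denominator_pos:
  assumes "x \<in> S3" "m > 0"
  shows "m\<^sup>2 * (1 + Im (snd x)) + (1 - Im (snd x)) > 0"
proof -
  have "(Im (snd x))\<^sup>2 \<le> 1"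
    using assms(1) unfolding mem_S3 using zero_le_power2[of "norm (fst x)"] zero_le_power2[of "Re (snd x)"] by linarith
  then have k: "\<bar>Im (snd x)\<bar> \<le> 1"
    by (simp add: abs_square_le_1)
  show ?thesis
  proof (cases "Im (snd x) = 1")
    case False
    then show ?thesis using k assms by (intro add_nonneg_pos mult_nonneg_nonneg) auto
  qed (use assms in simp)
qed

lemma dilation_one: "dilation 1 x = x"
  by (cases x) (simp add: dilation_def complex_eq_iff)

lemma dilation_in_S3:
  assumes "x \<in> S3" "m > 0"
  shows "dilation m x \<in> S3"
proof -
  define k where "k = Im (snd x)"
  define d where "d = m\<^sup>2 * (1 + k) + (1 - k)"
  have d: "d > 0"
    using dilation_denominator_pos[OF assms] by (simp add: d_def k_def)
  have E: "(norm (fst x))\<^sup>2 + (Re (snd x))\<^sup>2 = 1 - k\<^sup>2"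
    using assms(1) by (simp add: mem_S3 k_def)
  define n where "n = m\<^sup>2 * (1 + k) - (1 - k)"
  have "(norm ((2 * m / d) *\<^sub>R fst x))\<^sup>2 + (2 * m * Re (snd x) / d)\<^sup>2 + (n / d)\<^sup>2
      = ((2 * m)\<^sup>2 * ((norm (fst x))\<^sup>2 + (Re (snd x))\<^sup>2) + n\<^sup>2) / d\<^sup>2"
    by (simp add: power_divide power_mult_distrib add_divide_distrib distrib_left)
  \<comment> \<open>With \<open>u = m\<^sup>2 * (1 + k)\<close> and \<open>v = 1 - k\<close> this is
    the identity \<open>4 * u * v + (u - v)\<^sup>2 = (u + v)\<^sup>2\<close>.\<close>
  also have "(2 * m)\<^sup>2 * ((norm (fst x))\<^sup>2 + (Re (snd x))\<^sup>2) + n\<^sup>2 = d\<^sup>2"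
    unfolding d_def n_def E by (simp add: power2_eq_square algebra_simps)
  also have "d\<^sup>2 / d\<^sup>2 = 1"
    using d by simp
  finally show ?thesis
    unfolding mem_S3 dilation_def Let_def fst_conv snd_conv complex.sel
    by (simp only: k_def[symmetric] d_def[symmetric] n_def[symmetric])
qed

text \<open>The group law supplies the inverse of \<open>dilation m\<close> as
  \<open>dilation (1 / m)\<close>, which makes both directions of the diffeomorphism instances of
  one smoothness lemma.\<close>

lemma dilation_dilation:
  assumes "x \<in> S3" "m > 0" "l > 0"
  shows "dilation l (dilation m x) = dilation (l * m) x"
proof -
  define k where "k = Im (snd x)"
  define d where "d = m\<^sup>2 * (1 + k) + (1 - k)"
  define k' where "k' = (m\<^sup>2 * (1 + k) - (1 - k)) / d"
  define e where "e = (l * m)\<^sup>2 * (1 + k) + (1 - k)"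
  have d: "d > 0"
    using dilation_denominator_pos[OF assms(1,2)] by (simp add: d_def k_def)
  have e: "e > 0"
    using dilation_denominator_pos[OF assms(1), of "l * m"] assms by (simp add: e_def k_def)
  \<comment> \<open>Up to the common factor \<open>2 / d\<close>, the pair \<open>1 + k\<close>,
    \<open>1 - k\<close> becomes \<open>m\<^sup>2 * (1 + k)\<close>, \<open>1 - k\<close>; in these
    homogeneous coordinates composition just multiplies the factors.\<close>
  have k': "1 + k' = 2 * m\<^sup>2 * (1 + k) / d" "1 - k' = 2 * (1 - k) / d"
    using d by (simp_all add: k'_def field_simps) (simp_all add: d_def algebra_simps)
  have den: "l\<^sup>2 * (1 + k') + (1 - k') = 2 * e / d"
    unfolding k' e_def using d by (simp add: field_simps)
  have num: "l\<^sup>2 * (1 + k') - (1 - k') = 2 * ((l * m)\<^sup>2 * (1 + k) - (1 - k)) / d"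
    unfolding k' using d by (simp add: field_simps)
  have m: "dilation m x = ((2 * m / d) *\<^sub>R fst x, Complex (2 * m * Re (snd x) / d) k')"
    by (simp add: dilation_def Let_def flip: k_def d_def k'_def)
  show ?thesis
    unfolding m using d e
    by (simp add: dilation_def Let_def den num prod_eq_iff flip: k_def e_def)
      (simp add: field_simps)
qed

lemma bij_betw_dilation:
  assumes "m > 0"
  shows "bij_betw (dilation m) S3 S3"
proof (rule bij_betw_byWitness[where f' = "dilation (1 / m)"])
  show "\<forall>x\<in>S3. dilation (1 / m) (dilation m x) = x" "\<forall>x\<in>S3. dilation m (dilation (1 / m) x) = x"
    using assms by (simp_all add: dilation_dilation dilation_one)
qed (use assms dilation_in_S3 in auto)

lemma Ck_on_dilation:
  assumes "open U" "Ck_on k U m" "Ck_on k U f"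
    and "\<And>x. x \<in> U \<Longrightarrow> (m x)\<^sup>2 * (1 + Im (snd (f x))) + (1 - Im (snd (f x))) \<noteq> 0"
  shows "Ck_on k U (\<lambda>x. dilation (m x) (f x))"
  unfolding dilation_def Let_def using assms
  by (intro Ck_on_intros) auto

lemma smooth_on_dilation:
  assumes "m > 0"
  shows "smooth_on S3 (dilation m)"
proof -
  let ?U = "{x. m\<^sup>2 * (1 + Im (snd x)) + (1 - Im (snd x)) \<noteq> 0}"
  have U: "open ?U"
    by (intro open_Collect_neq continuous_intros)
  show ?thesis
    by (rule smooth_onI[OF U])
      (use assms dilation_denominator_pos U in \<open>fastforce intro!: Ck_on_dilation Ck_on_intros\<close>)+
qed

lemma diffeomorphism_dilation:
  assumes "m > 0"
  shows "diffeomorphism S3 S3 (dilation m)"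
proof -
  note bij = bij_betw_dilation[OF assms]
  have "inv_into S3 (dilation m) y = dilation (1 / m) y" if "y \<in> S3" for y
  proof (rule inv_into_f_eq)
    show "inj_on (dilation m) S3" using bij by (simp add: bij_betw_def)
    show "dilation (1 / m) y \<in> S3" "dilation m (dilation (1 / m) y) = y"
      using that assms by (simp_all add: dilation_in_S3 dilation_dilation dilation_one)
  qed
  then show ?thesis
    unfolding diffeomorphism_def
    using bij smooth_on_dilation[OF assms] smooth_on_dilation[of "1 / m"] assms
    by (simp cong: smooth_on_cong)
qed

lemma ambient_isotopy_dilation:
  assumes "m > 0"
  shows "ambient_isotopy (\<lambda>(x, t). dilation (1 + t * (m - 1)) x)"
proof -
  have pos: "1 + t * (m - 1) > 0" if "t \<in> {0..1}" for t
  proof -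
    have "1 + t * (m - 1) = (1 - t) + t * m" by algebra
    also have "\<dots> > 0"
      using that assms by (cases "t = 1") (auto intro: add_pos_nonneg)
    finally show ?thesis .
  qed
  let ?U = "{p :: (complex \<times> complex) \<times> real.
    (1 + snd p * (m - 1))\<^sup>2 * (1 + Im (snd (fst p))) + (1 - Im (snd (fst p))) \<noteq> 0}"
  have U: "open ?U"
    by (intro open_Collect_neq continuous_intros)
  have "S3 \<times> {0..1} \<subseteq> ?U"
    using dilation_denominator_pos pos by (fastforce)
  moreover have "Ck_on k ?U (\<lambda>p. dilation (1 + snd p * (m - 1)) (fst p))" for k
    using U by (intro Ck_on_dilation Ck_on_intros) auto
  ultimately have "smooth_on (S3 \<times> {0..1}) (\<lambda>p. dilation (1 + snd p * (m - 1)) (fst p))"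
    using U by (intro smooth_onI[of ?U])
  then show ?thesis
    using pos by (simp add: ambient_isotopy_def diffeomorphism_dilation dilation_one case_prod_unfold)
qed

lemma ambient_isotopic_refl: "ambient_isotopic K K"
  unfolding ambient_isotopic_def
proof (intro exI conjI)
  show "ambient_isotopy (\<lambda>(x, t). dilation (1 + t * (1 - 1)) x)"
    by (rule ambient_isotopy_dilation) simp
  show "takes_knot (\<lambda>(x, t). dilation (1 + t * (1 - 1)) x) K K"
    by (simp add: takes_knot_def dilation_one)
qed

section \<open>Stereographic projection\<close>

lemma inv_stereographic_in_S3: "inv_stereographic p \<in> S3"
proof -
  define r where "r = (norm (fst p))\<^sup>2 + (snd p)\<^sup>2"
  have r: "r \<ge> 0" by (simp add: r_def)
  have "(2 * norm (fst p) / (r + 1))\<^sup>2 + (2 * snd p / (r + 1))\<^sup>2 + ((r - 1) / (r + 1))\<^sup>2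
      = (4 * r + (r - 1)\<^sup>2) / (r + 1)\<^sup>2"
    by (simp add: r_def power_divide add_divide_distrib power_mult_distrib)
  also have "\<dots> = 1"
    using r by (simp add: divide_eq_1_iff) (simp add: power2_eq_square algebra_simps)
  finally show ?thesis
    using r unfolding mem_S3 inv_stereographic_def Let_def r_def[symmetric] fst_conv snd_conv
      complex.sel norm_divide norm_mult norm_of_real by simp
qed

text \<open>A left inverse of \<open>inv_stereographic\<close>, smooth off the pole
  \<open>(0, \<i>)\<close>; it gives injectivity of that map and of its differential.\<close>

definition stereographic :: "complex \<times> complex \<Rightarrow> complex \<times> real" where
  "stereographic x = (fst x / of_real (1 - Im (snd x)), Re (snd x) / (1 - Im (snd x)))"

lemma stereographic_inv_stereographic: "stereographic (inv_stereographic p) = p"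
proof -
  define r where "r = (norm (fst p))\<^sup>2 + (snd p)\<^sup>2"
  have r: "r + 1 > 0" by (simp add: r_def add_nonneg_pos)
  have k: "1 - (r - 1) / (r + 1) = 2 / (r + 1)"
    using r by (simp add: field_simps)
  have "2 * c / complex_of_real (r + 1) / complex_of_real (2 / (r + 1)) = c" for c
    using r by (simp add: nonzero_of_real_divide del: of_real_add)
  moreover have "2 * h / (r + 1) / (2 / (r + 1)) = h" for h
    using r by simp
  ultimately show ?thesis
    unfolding inv_stereographic_def stereographic_def Let_def r_def[symmetric] fst_conv snd_conv
      complex.sel k by simp
qed

lemma Im_inv_stereographic_less: "Im (snd (inv_stereographic p)) < 1"
proof -
  have "(norm (fst p))\<^sup>2 + (snd p)\<^sup>2 + 1 > 0"
    by (simp add: add_nonneg_pos)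
  then show ?thesis
    unfolding inv_stereographic_def Let_def snd_conv complex.sel by (subst divide_less_eq_1_pos) simp_all
qed

lemma dilation_inv_stereographic:
  assumes "m > 0"
  shows "dilation m (inv_stereographic p) = inv_stereographic (m *\<^sub>R p)"
proof -
  define r where "r = (norm (fst p))\<^sup>2 + (snd p)\<^sup>2"
  have r: "r \<ge> 0" by (simp add: r_def)
  then have pos: "r + 1 > 0" "m\<^sup>2 * r + 1 > 0"
    by (auto intro: add_nonneg_pos)
  then have nz: "2 * (m\<^sup>2 * r) + 2 \<noteq> 0" "m\<^sup>2 * r + 1 \<noteq> 0"
    by auto
  define k where "k = (r - 1) / (r + 1)"
  have k: "1 + k = 2 * r / (r + 1)" "1 - k = 2 / (r + 1)"
    using pos by (simp_all add: k_def field_simps)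
  have d: "m\<^sup>2 * (1 + k) + (1 - k) = 2 * (m\<^sup>2 * r + 1) / (r + 1)"
      "m\<^sup>2 * (1 + k) - (1 - k) = 2 * (m\<^sup>2 * r - 1) / (r + 1)"
    unfolding k by (simp_all add: add_divide_distrib diff_divide_distrib algebra_simps)
  have r': "(norm (fst (m *\<^sub>R p)))\<^sup>2 + (snd (m *\<^sub>R p))\<^sup>2 = m\<^sup>2 * r"
    by (simp add: r_def power_mult_distrib algebra_simps)
  have "inv_stereographic p = (2 * fst p / of_real (r + 1), Complex (2 * snd p / (r + 1)) k)"
    unfolding inv_stereographic_def Let_def k_def r_def ..
  moreover have "inv_stereographic (m *\<^sub>R p) = (2 * fst (m *\<^sub>R p) / of_real (m\<^sup>2 * r + 1),
      Complex (2 * snd (m *\<^sub>R p) / (m\<^sup>2 * r + 1)) ((m\<^sup>2 * r - 1) / (m\<^sup>2 * r + 1)))"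
    unfolding inv_stereographic_def Let_def r' ..
  ultimately show ?thesis
    using pos nz by (simp add: dilation_def Let_def d prod_eq_iff complex_eq_iff)
      (simp add: frac_eq_eq algebra_simps)
qed

lemma Ck_on_inv_stereographic:
  assumes "open U" "Ck_on k U f"
  shows "Ck_on k U (\<lambda>x. inv_stereographic (f x))"
proof -
  have "(norm (fst (f x)))\<^sup>2 + (snd (f x))\<^sup>2 + 1 \<noteq> 0" for x
    by (smt (verit) zero_le_power2)
  then show ?thesis
    unfolding inv_stereographic_def Let_def cmod_power2 using assms
    by (intro Ck_on_intros) (auto simp: complex_eq_iff)
qed

section \<open>The linking obstruction\<close>

text \<open>Lifted to the line, \<open>G (cis t) - \<i> * n * t\<close> is continuous with values in
  the integer multiples of \<open>2 * pi * \<i>\<close>, hence constant; yet over one period it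
  drops by \<open>2 * pi * n * \<i>\<close>.\<close>

lemma no_continuous_log_power_circle:
  assumes "n > 0" "continuous_on S1 G"
  shows "\<exists>z\<in>S1. z ^ n \<noteq> exp (G z)"
proof (rule ccontr)
  assume "\<not> ?thesis"
  then have "cis t ^ n = exp (G (cis t))" for t :: real
    by (auto simp: mem_sphere_0)
  then have G: "exp (G (cis t)) = cis (n * t)" for t :: real
    using Complex.DeMoivre[of t n] by metis
  define h where "h t = G (cis t) - \<i> * of_real (real n * t)" for t :: real
  have exp_h: "exp (h t) = 1" for t :: real
    using G[of t] by (simp add: h_def exp_diff cis_conv_exp)
  have "h constant_on UNIV"
  proof (rule continuous_discrete_range_constant)
    show "continuous_on UNIV h"
      unfolding h_def
      by (intro continuous_intros continuous_on_compose2[OF assms(2)]) (auto simp: mem_sphere_0)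
    fix s
    have "2 * pi \<le> norm (h t - h s)" if "h t \<noteq> h s" for t
    proof -
      obtain i j :: int where ij: "Re (h t) = 0" "Im (h t) = of_int (2 * i) * pi"
          "Re (h s) = 0" "Im (h s) = of_int (2 * j) * pi"
        using exp_h[of t] exp_h[of s] unfolding exp_eq_1 by blast
      then have "i \<noteq> j"
        using that by (auto simp: complex_eq_iff)
      then have "1 \<le> \<bar>real_of_int (i - j)\<bar>"
        by linarith
      then have "2 * pi \<le> \<bar>real_of_int (i - j)\<bar> * (2 * pi)"
        by simp
      also have "\<dots> = \<bar>Im (h t - h s)\<bar>"
      proof -
        have "Im (h t - h s) = real_of_int (i - j) * (2 * pi)"
          by (simp add: ij algebra_simps)
        then show ?thesis by (simp only: abs_mult) simp
      qed
      also have "\<dots> \<le> norm (h t - h s)"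
        by (rule abs_Im_le_cmod)
      finally show ?thesis .
    qed
    then show "\<exists>e>0. \<forall>y. y \<in> UNIV \<and> h y \<noteq> h s \<longrightarrow> e \<le> norm (h y - h s)"
      by (intro exI[of _ "2 * pi"]) auto
  qed (rule connected_UNIV)
  then have "h 0 = h (2 * pi)"
    unfolding constant_on_def by fastforce
  then show False
    using assms(1) by (simp add: h_def)
qed

text \<open>The polynomial of the cusp, whose link is the trefoil. The factor \<open>sqrt 2\<close>
  fits the parametrization: for \<open>a = z\<^sup>2 / sqrt 2\<close> and
  \<open>b = z ^ 3 / sqrt 2\<close> both terms equal \<open>z ^ 6 / 2\<close>.\<close>

definition milnor :: "complex \<times> complex \<Rightarrow> complex" where
  "milnor x = of_real (sqrt 2) * fst x ^ 3 - snd x ^ 2"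

lemma continuous_on_milnor [continuous_intros]:
  "continuous_on A f \<Longrightarrow> continuous_on A (\<lambda>x. milnor (f x))"
  unfolding milnor_def by (intro continuous_intros)

text \<open>Taking norms on the sphere gives \<open>u ^ 3 + u\<^sup>2 = 2\<close>, whose only
  nonnegative solution is 1. So both coordinates, scaled by \<open>sqrt 2\<close>, are unit complex
  numbers with \<open>a ^ 3 = b\<^sup>2\<close>.\<close>

lemma milnor_eq_0_imp:
  assumes "x \<in> S3" "milnor x = 0"
  shows "x \<in> standard_trefoil ` S1"
proof -
  define u where "u = sqrt 2 * norm (fst x)"
  have u: "u \<ge> 0" by (simp add: u_def)
  have eq: "of_real (sqrt 2) * fst x ^ 3 = snd x ^ 2"
    using assms(2) by (simp add: milnor_def)
  have s: "sqrt 2 * sqrt 2 = 2" by simp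
  have "norm (of_real (sqrt 2) * fst x ^ 3) = norm (snd x ^ 2)"
    using eq by simp
  then have n: "sqrt 2 * norm (fst x) ^ 3 = (norm (snd x))\<^sup>2"
    by (simp add: norm_mult norm_power)
  have "sqrt 2 * norm (fst x) ^ 3 = u ^ 3 / 2"
    by (simp add: u_def power3_eq_cube)
  moreover have "(norm (fst x))\<^sup>2 = u\<^sup>2 / 2"
    by (simp add: u_def power_mult_distrib)
  moreover have "(norm (fst x))\<^sup>2 + (norm (snd x))\<^sup>2 = 1"
    using assms(1) by (simp add: mem_S3 cmod_power2)
  ultimately have "u ^ 3 + u\<^sup>2 = 2"
    using n by simp
  then have "(u - 1) * (u\<^sup>2 + 2 * u + 2) = 0"
    by (simp add: power2_eq_square power3_eq_cube algebra_simps)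
  moreover have "u\<^sup>2 + 2 * u + 2 > 0"
    using u by (simp add: add_nonneg_pos)
  ultimately have u1: "u = 1"
    by simp
  define a where "a = of_real (sqrt 2) * fst x"
  define b where "b = of_real (sqrt 2) * snd x"
  have c2: "complex_of_real (sqrt 2) * of_real (sqrt 2) = 2"
    by (simp flip: of_real_mult)
  have na: "norm a = 1"
    using u1 by (simp add: a_def u_def norm_mult)
  then have a0: "a \<noteq> 0" by auto
  have "a ^ 3 = of_real (sqrt 2) * of_real (sqrt 2) * (of_real (sqrt 2) * fst x ^ 3)"
    unfolding a_def by (simp only: power3_eq_cube mult_ac)
  also have "\<dots> = b ^ 2"
    unfolding b_def eq by (simp only: power2_eq_square mult_ac)
  finally have ab: "a ^ 3 = b ^ 2" .
  \<comment> \<open>The parameter of the cusp is recovered as the quotient of its cube by its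
    square.\<close>
  define z where "z = b / a"
  have "norm b ^ 2 = 1"
    using ab na by (metis norm_power power_one)
  then have nb: "norm b = 1"
    by (simp add: power2_eq_1_iff) (smt (verit) norm_ge_zero)
  have z2: "z ^ 2 = a"
    using a0 by (simp add: z_def power_divide flip: ab) (simp add: power2_eq_square power3_eq_cube)
  have z3: "z ^ 3 = b"
  proof -
    have "z ^ 3 = z * z ^ 2" by algebra
    then show ?thesis unfolding z2 using a0 by (simp add: z_def)
  qed
  have "x = standard_trefoil z"
    unfolding standard_trefoil_def z2 z3 by (simp add: a_def b_def)
  moreover have "z \<in> S1"
    using na nb by (simp add: z_def norm_divide mem_sphere_0)
  ultimately show ?thesis by blast
qed

text \<open>Phrased for sets, because \<open>takes_knot\<close> compares images only and says
  nothing about how the parametrizations correspond.\<close>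

definition milnor_log :: "(complex \<times> complex) set \<Rightarrow> bool" where
  "milnor_log C \<longleftrightarrow> (\<exists>g. continuous_on C g \<and> (\<forall>x\<in>C. milnor x = exp (g x)))"

lemma milnor_log_ambient_isotopy:
  assumes H: "ambient_isotopy H"
    and fixed: "\<And>t x. t \<in> {0..1} \<Longrightarrow> x \<in> standard_trefoil ` S1 \<Longrightarrow> H (x, t) = x"
    and C: "C \<subseteq> S3" "C \<inter> standard_trefoil ` S1 = {}" and T: "standard_trefoil ` S1 \<subseteq> S3"
    and log: "milnor_log C"
  shows "milnor_log ((\<lambda>x. H (x, 1)) ` C)"
proof -
  have bij: "bij_betw (\<lambda>x. H (x, t)) S3 S3" if "t \<in> {0..1}" for t
    using H that by (auto simp: ambient_isotopy_def diffeomorphism_def)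
  have nonzero: "milnor (H (x, t)) \<noteq> 0" if "t \<in> {0..1}" "x \<in> C" for x t
  proof
    assume "milnor (H (x, t)) = 0"
    moreover have "H (x, t) \<in> S3"
      using bij_betw_apply[OF bij[OF that(1)]] that(2) C(1) by blast
    ultimately have y: "H (x, t) \<in> standard_trefoil ` S1"
      by (rule milnor_eq_0_imp[rotated])
    \<comment> \<open>The trefoil point reached by \<open>x\<close> is also its own image at time
      \<open>t\<close>; injectivity makes \<open>x\<close> that point, contrary to \<open>C\<close>
      being disjoint from the trefoil.\<close>
    then have "H (H (x, t), t) = H (x, t)"
      by (rule fixed[OF that(1)])
    then have "H (x, t) = x"
      using bij[OF that(1)] y T C that by (auto simp: bij_betw_def dest!: inj_onD)
    then show False
      using y that C by auto
  qed
  have H0: "H (x, 0) = x" if "x \<in> C" for x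
    using H C that by (auto simp: ambient_isotopy_def)
  have contH: "continuous_on (S3 \<times> {0..1}) H"
    using H by (simp add: ambient_isotopy_def smooth_on_imp_continuous_on)
  \<comment> \<open>Following the isotopy by \<open>milnor\<close> gives a homotopy in the punctured
    plane. A map into it has a continuous logarithm exactly if it is null-homotopic there, so the
    logarithm at time 0 yields one at time 1.\<close>
  have "homotopic_with_canon (\<lambda>h. True) C (-{0}) milnor (\<lambda>x. milnor (H (x, 1)))"
    unfolding homotopic_with[where P = "\<lambda>h. True", OF refl]
  proof (intro exI conjI ballI)
    let ?h = "\<lambda>p. milnor (H (snd p, fst p))"
    have "continuous_on ({0..1} \<times> C) ?h"
      using C by (intro continuous_intros continuous_on_compose2[OF contH]) auto
    then show "continuous_map (prod_topology (top_of_set {0..1}) (top_of_set C)) (top_of_set (-{0})) ?h"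
      using nonzero by (auto simp: prod_topology_subtopology_eu continuous_map_in_subtopology)
  qed (use H0 in auto)
  moreover obtain a where "homotopic_with_canon (\<lambda>h. True) C (-{0}) milnor (\<lambda>x. a)"
    using log inessential_eq_continuous_logarithm[of C milnor] by (auto simp: milnor_log_def)
  ultimately have "homotopic_with_canon (\<lambda>h. True) C (-{0}) (\<lambda>x. milnor (H (x, 1))) (\<lambda>x. a)"
    using homotopic_with_trans homotopic_with_symD by blast
  then obtain g where g: "continuous_on C g" "\<And>x. x \<in> C \<Longrightarrow> milnor (H (x, 1)) = exp (g x)"
    using inessential_eq_continuous_logarithm[of C "\<lambda>x. milnor (H (x, 1))"] by auto
  \<comment> \<open>So far \<open>g\<close> lives on \<open>C\<close> and is a logarithm of
    \<open>milnor\<close> after the end map; the continuous inverse of the end map moves it to the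
    image.\<close>
  let ?H1 = "\<lambda>x. H (x, 1)"
  have diffeo: "diffeomorphism S3 S3 ?H1"
    using H by (auto simp: ambient_isotopy_def)
  then have inv: "inv_into S3 ?H1 (?H1 x) = x" if "x \<in> C" for x
    using C that by (auto simp: diffeomorphism_def bij_betw_def intro!: inv_into_f_f)
  have sub: "?H1 ` C \<subseteq> S3"
    using C bij_betw_apply[OF bij[of 1]] by auto
  have "continuous_on (?H1 ` C) (inv_into S3 ?H1)"
    using diffeo sub by (auto simp: diffeomorphism_def
        intro: continuous_on_subset dest!: smooth_on_imp_continuous_on)
  then have "continuous_on (?H1 ` C) (\<lambda>y. g (inv_into S3 ?H1 y))"
    by (rule continuous_on_compose2[OF g(1)]) (use inv in auto)
  then show ?thesis
    unfolding milnor_log_def using g(2) inv by (intro exI[of _ "\<lambda>y. g (inv_into S3 ?H1 y)"]) auto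
qed

section \<open>Tubular neighborhoods\<close>

lemma abs_Re_Im_D2:
  assumes "w \<in> D2"
  shows "\<bar>Re w\<bar> \<le> 1" "\<bar>Im w\<bar> \<le> 1"
  using assms abs_Re_le_cmod[of w] abs_Im_le_cmod[of w] by (auto simp: mem_cball_0)

section \<open>Solid tori around the figure eight knots\<close>

lemma primitive_cube_root_of_unity:
  fixes c :: complex
  assumes "c ^ 3 = 1" "c \<noteq> 1"
  shows "Re c = - 1 / 2" "(Im c)\<^sup>2 = 3 / 4"
proof -
  have "(c - 1) * (c\<^sup>2 + c + 1) = 0"
    using assms(1) by (simp add: power2_eq_square power3_eq_cube algebra_simps)
  then have q: "c\<^sup>2 + c + 1 = 0"
    using assms(2) by simp
  have im: "Im c * (2 * Re c + 1) = 0" and re: "(Re c)\<^sup>2 - (Im c)\<^sup>2 + Re c + 1 = 0"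
    using arg_cong[OF q, of Im] arg_cong[OF q, of Re]
    by (simp_all add: power2_eq_square algebra_simps)
  have "Im c \<noteq> 0"
  proof
    assume "Im c = 0"
    then have "(Re c + 1 / 2)\<^sup>2 + 3 / 4 = 0"
      using re by (simp add: power2_eq_square algebra_simps)
    then show False
      by (smt (verit) zero_le_power2 divide_pos_pos)
  qed
  then show x: "Re c = - 1 / 2"
    using im by simp
  show "(Im c)\<^sup>2 = 3 / 4"
    using re unfolding x by (simp add: power2_eq_square)
qed

text \<open>Thickens the knot inside the half-planes through the axis: the disc shifts radius and
  height and leaves the angle \<open>3 * t\<close> alone. No normal frame is required, as the knot
  crosses these half-planes transversally. Each of them meets the knot in three points, and discs of
  radius 1/10 around these are disjoint.\<close>

definition figure_eight_tube :: "complex \<times> complex \<Rightarrow> complex \<times> real" where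
  "figure_eight_tube p =
     (of_real (2 + Re (fst p ^ 2) + Re (snd p) / 10) * fst p ^ 3, Im (fst p ^ 4) + Im (snd p) / 10)"

lemma figure_eight_tube_radius_pos:
  assumes "z \<in> S1" "w \<in> D2"
  shows "2 + Re (z ^ 2) + Re w / 10 > 0"
proof -
  have "\<bar>Re (z ^ 2)\<bar> \<le> 1"
    using abs_Re_le_cmod[of "z ^ 2"] assms(1) by (simp add: norm_power mem_sphere_0)
  then show ?thesis
    using abs_Re_Im_D2[OF assms(2)] by linarith
qed

text \<open>
  Points of the tube with the same image lie at the same angle in \<open>\<real>\<^sup>3\<close>, so their parameters
  differ by a cube root of unity. If it is not \<open>1\<close>, the differences \<open>a\<close> of the radii and \<open>b\<close> of the
  heights of the two core points satisfy \<open>2 * a\<^sup>2 - 3 = \<plusminus> sqrt 3 * b\<close>, so they are not both small.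
\<close>

lemma inj_on_figure_eight_tube: "inj_on figure_eight_tube (S1 \<times> D2)"
proof (rule inj_onI, clarify)
  fix z w z' w'
  assume mem: "z \<in> S1" "w \<in> D2" "z' \<in> S1" "w' \<in> D2"
    and eq: "figure_eight_tube (z, w) = figure_eight_tube (z', w')"
  define r where "r = 2 + Re (z ^ 2) + Re w / 10"
  define r' where "r' = 2 + Re (z' ^ 2) + Re w' / 10"
  have pos: "r > 0" "r' > 0"
    using figure_eight_tube_radius_pos mem by (auto simp: r_def r'_def)
  have nz: "norm z = 1" "norm z' = 1"
    using mem by (auto simp: mem_sphere_0)
  have eq1: "of_real r * z ^ 3 = of_real r' * z' ^ 3"
    and eq2: "Im (z ^ 4) + Im w / 10 = Im (z' ^ 4) + Im w' / 10"
    using eq by (auto simp: figure_eight_tube_def r_def r'_def)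
  have "norm (of_real r * z ^ 3) = norm (of_real r' * z' ^ 3)"
    using eq1 by simp
  then have rr: "r = r'"
    using pos nz by (simp add: norm_mult norm_power)
  then have z3: "z ^ 3 = z' ^ 3"
    using eq1 pos by simp
  have z0: "z \<noteq> 0" using nz by auto
  define c where "c = z' / z"
  have zc: "z' = c * z" using z0 by (simp add: c_def)
  have c3: "c ^ 3 = 1"
    using z3[symmetric] z0 by (simp add: c_def power_divide)
  have "c = 1"
  proof (rule ccontr)
    assume "c \<noteq> 1"
    note c = primitive_cube_root_of_unity[OF c3 this]
    define p q y where "p = Re (z ^ 2)" and "q = Im (z ^ 2)" and "y = Im c"
    have y: "y * y = 3 / 4"
      using c by (simp add: y_def power2_eq_square)
    have c2: "c ^ 2 = Complex (- 1 / 2) (- y)"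
      using c(1) y by (simp add: complex_eq_iff power2_eq_square y_def)
    have pq: "p\<^sup>2 + q\<^sup>2 = 1"
      using nz(1) cmod_power2[of "z ^ 2"] by (simp add: p_def q_def norm_power)
    have z2: "z ^ 2 = Complex p q" by (simp add: p_def q_def)
    have z'2: "z' ^ 2 = Complex (- p / 2 + y * q) (- q / 2 - y * p)"
      unfolding zc power_mult_distrib c2 z2 by (simp add: complex_eq_iff)
    have four: "v ^ 4 = (v ^ 2) ^ 2" for v :: complex by simp
    define a where "a = Re (z ^ 2) - Re (z' ^ 2)"
    define b where "b = Im (z ^ 4) - Im (z' ^ 4)"
    have a: "a = 3 * p / 2 - y * q"
      unfolding a_def z'2 z2 by simp
    have "b = 2 * p * q - 2 * (- p / 2 + y * q) * (- q / 2 - y * p)"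
      unfolding b_def four z'2 z2 by (simp add: power2_eq_square)
    also have "\<dots> = 3 / 2 * p * q + 2 * (y * y) * p * q - y * (p\<^sup>2 - q\<^sup>2)"
      by (simp add: power2_eq_square field_simps)
    also have "\<dots> = 3 * p * q - y * (p\<^sup>2 - q\<^sup>2)"
      unfolding y by simp
    finally have b: "b = 3 * p * q - y * (p\<^sup>2 - q\<^sup>2)" .
    have "2 * a\<^sup>2 - 3 * (p\<^sup>2 + q\<^sup>2) + 2 * y * b
        = 3 / 2 * p\<^sup>2 - 3 * q\<^sup>2 + 2 * (y * y) * q\<^sup>2 - 2 * (y * y) * (p\<^sup>2 - q\<^sup>2)"
      unfolding a b by (simp add: power2_eq_square field_simps)
    also have "\<dots> = 0"
      unfolding y by (simp add: field_simps)
    finally have key: "2 * a\<^sup>2 + 2 * y * b = 3"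
      using pq by simp
    \<comment> \<open>Equal radii and heights leave only the two disc shifts, at most 1/10 each.
      Then \<open>2 * a\<^sup>2 + 2 * y * b\<close> is at most 2/25 + 2/5, far from 3.\<close>
    have "\<bar>a\<bar> \<le> 1 / 5"
      using rr abs_Re_Im_D2[OF mem(2)] abs_Re_Im_D2[OF mem(4)]
      unfolding a_def r_def r'_def by linarith
    then have "a\<^sup>2 \<le> (1 / 5)\<^sup>2"
      using abs_le_square_iff[of a "1 / 5"] by simp
    moreover have "\<bar>b\<bar> \<le> 1 / 5"
      using eq2 abs_Re_Im_D2[OF mem(2)] abs_Re_Im_D2[OF mem(4)]
      unfolding b_def by linarith
    moreover have "\<bar>y\<bar> \<le> 1"
      using y abs_square_le_1[of y] by (simp add: power2_eq_square)
    ultimately have "\<bar>y * b\<bar> \<le> 1 * (1 / 5)"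
      unfolding abs_mult by (intro mult_mono) auto
    then show False
      using key \<open>a\<^sup>2 \<le> (1 / 5)\<^sup>2\<close> by (simp add: power2_eq_square abs_le_iff)
  qed
  then have "z = z'" using zc by simp
  then show "z = z' \<and> w = w'"
    using rr eq2 unfolding r_def r'_def by (auto intro: complex_eqI)
qed

text \<open>In the rotating frame \<open>cis (3 * t)\<close>, \<open>\<i> * cis (3 * t)\<close> the
  angular part of the differential is \<open>3 * r * fst h\<close>. As \<open>r > 0\<close>, a
  kernel vector has \<open>fst h = 0\<close>, and the radial and vertical parts then reduce to the
  disc coordinates over 10.\<close>

lemma has_derivative_figure_eight_tube:
  assumes "w \<in> D2"
  shows "\<exists>D. ((\<lambda>(s, v). figure_eight_tube (cis s, v)) has_derivative D) (at (t, w) within S) \<and> inj D"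
proof -
  define r where "r = 2 + cos (2 * t) + Re w / 10"
  let ?D = "\<lambda>h :: real \<times> complex.
    (of_real (Re (snd h) / 10 - 2 * sin (2 * t) * fst h) * cis (3 * t)
       + of_real (3 * r * fst h) * (\<i> * cis (3 * t)), 4 * cos (4 * t) * fst h + Im (snd h) / 10)"
  have eq: "(\<lambda>(s, v). figure_eight_tube (cis s, v)) =
     (\<lambda>p. (of_real (2 + cos (2 * fst p) + Re (snd p) / 10) * cis (3 * fst p),
          sin (4 * fst p) + Im (snd p) / 10))"
    by (auto simp: figure_eight_tube_def Complex.DeMoivre)
  have "((\<lambda>(s, v). figure_eight_tube (cis s, v)) has_derivative ?D) (at (t, w) within S)"
    unfolding eq
    by (rule derivative_eq_intros refl | simp)+
      (auto simp: fun_eq_iff r_def scaleR_conv_of_real algebra_simps)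
  moreover have "inj ?D"
  proof -
    have "linear ?D"
      using calculation has_derivative_linear by blast
    moreover have "h = 0" if "?D h = 0" for h
    proof -
      have c0: "cis (3 * t) \<noteq> 0" by simp
      have "(of_real (Re (snd h) / 10 - 2 * sin (2 * t) * fst h) + of_real (3 * r * fst h) * \<i>) * cis (3 * t) = 0"
        using that by (simp add: algebra_simps prod_eq_iff)
      then have e: "of_real (Re (snd h) / 10 - 2 * sin (2 * t) * fst h) + of_real (3 * r * fst h) * \<i> = 0"
        using c0 by (metis mult_eq_0_iff)
      have "r > 0"
        using figure_eight_tube_radius_pos[of "cis t" w] assms by (simp add: r_def Complex.DeMoivre mem_sphere_0)
      then have f: "fst h = 0"
        using arg_cong[OF e, of Im] by simp
      then have "snd h = 0"
        using arg_cong[OF e, of Re] that by (simp add: complex_eq_iff prod_eq_iff)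
      with f show ?thesis by (simp add: prod_eq_iff)
    qed
    ultimately show ?thesis
      using linear_injective_0 by blast
  qed
  ultimately show ?thesis by blast
qed

text \<open>By the chain rule the derivative of \<open>stereographic\<close> is a left inverse of
  \<open>J\<close>, so no Jacobian has to be computed.\<close>

lemma has_derivative_inv_stereographic:
  "\<exists>J. (inv_stereographic has_derivative J) (at p) \<and> inj J"
proof -
  have "Ck_on (Suc 0) UNIV inv_stereographic"
    using Ck_on_inv_stereographic[OF open_UNIV Ck_on_ident[OF open_UNIV]] .
  then have "inv_stereographic differentiable (at p)"
    unfolding Ck_on.simps(2) by blast
  then obtain J where J: "(inv_stereographic has_derivative J) (at p)"
    unfolding differentiable_def by blast
  let ?x = "inv_stereographic p"
  let ?U = "{x :: complex \<times> complex. 1 - Im (snd x) \<noteq> 0}"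
  have U: "open ?U"
    by (intro open_Collect_neq continuous_intros)
  have "Ck_on (Suc 0) ?U stereographic"
    unfolding stereographic_def by (intro Ck_on_intros U) (auto simp: complex_eq_iff)
  moreover have "?x \<in> ?U"
    using Im_inv_stereographic_less[of p] by simp
  ultimately have "stereographic differentiable (at ?x)"
    unfolding Ck_on.simps(2) by blast
  then obtain L where L: "(stereographic has_derivative L) (at ?x)"
    unfolding differentiable_def by blast
  have "((\<lambda>p. stereographic (inv_stereographic p)) has_derivative (\<lambda>h. L (J h))) (at p)"
    by (rule has_derivative_compose[OF J L])
  then have "((\<lambda>p. p) has_derivative (\<lambda>h. L (J h))) (at p)"
    by (simp add: stereographic_inv_stereographic)
  then have "(\<lambda>h. L (J h)) = (\<lambda>h. h)"
    by (rule has_derivative_unique) (rule has_derivative_ident)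
  then have "inj J"
    by (metis injI)
  with J show ?thesis by blast
qed

definition scaled_figure_eight :: "real \<Rightarrow> complex \<Rightarrow> complex \<times> complex" where
  "scaled_figure_eight m z = inv_stereographic (m *\<^sub>R figure_eight_tube (z, 0))"

definition figure_eight_nbhd :: "real \<Rightarrow> (complex \<times> complex) set" where
  "figure_eight_nbhd m = (\<lambda>p. inv_stereographic (m *\<^sub>R figure_eight_tube p)) ` (S1 \<times> D2)"

lemma closed_regular_neighborhood_figure_eight:
  assumes "m > 0"
  shows "closed_regular_neighborhood (scaled_figure_eight m) (figure_eight_nbhd m)"
  unfolding closed_regular_neighborhood_def
proof (rule exI[of _ "\<lambda>p. inv_stereographic (m *\<^sub>R figure_eight_tube p)"], intro conjI allI ballI)
  let ?\<phi> = "\<lambda>p. inv_stereographic (m *\<^sub>R figure_eight_tube p)"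
  have "Ck_on k UNIV ?\<phi>" for k
    unfolding figure_eight_tube_def
    by (intro Ck_on_inv_stereographic Ck_on_intros open_UNIV) auto
  then show "smooth_on (S1 \<times> D2) ?\<phi>"
    by (intro smooth_onI[OF open_UNIV]) auto
  show "inj_on ?\<phi> (S1 \<times> D2)"
  proof (rule inj_onI)
    fix x y assume "x \<in> S1 \<times> D2" "y \<in> S1 \<times> D2" "?\<phi> x = ?\<phi> y"
    then show "x = y"
      using assms inj_onD[OF inj_on_figure_eight_tube] stereographic_inv_stereographic
      by (metis scaleR_left_imp_eq less_numeral_extra(3))
  qed
  show "?\<phi> (z, 0) = scaled_figure_eight m z" for z
    by (simp add: scaled_figure_eight_def)
  show "?\<phi> ` (S1 \<times> D2) = figure_eight_nbhd m"
    by (simp add: figure_eight_nbhd_def)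
  show "figure_eight_nbhd m \<subseteq> S3"
    unfolding figure_eight_nbhd_def by (intro image_subsetI inv_stereographic_in_S3)
  fix t and w :: complex assume w: "w \<in> D2"
  obtain D where D: "((\<lambda>(s, v). figure_eight_tube (cis s, v)) has_derivative D) (at (t, w) within UNIV \<times> D2)"
      "inj D"
    using has_derivative_figure_eight_tube[OF w] by blast
  obtain J where J: "(inv_stereographic has_derivative J) (at (m *\<^sub>R figure_eight_tube (cis t, w)))" "inj J"
    using has_derivative_inv_stereographic by blast
  have "((\<lambda>q. m *\<^sub>R (\<lambda>(s, v). figure_eight_tube (cis s, v)) q) has_derivative (\<lambda>h. m *\<^sub>R D h))
      (at (t, w) within UNIV \<times> D2)"
    by (rule has_derivative_scaleR_right[OF D(1)])
  then have "((\<lambda>q. inv_stereographic (m *\<^sub>R (\<lambda>(s, v). figure_eight_tube (cis s, v)) q))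
      has_derivative (\<lambda>h. J (m *\<^sub>R D h))) (at (t, w) within UNIV \<times> D2)"
    by (rule has_derivative_compose) (simp add: J)
  moreover have "inj (\<lambda>h. J (m *\<^sub>R D h))"
  proof (rule injI)
    fix x y assume "J (m *\<^sub>R D x) = J (m *\<^sub>R D y)"
    then have "m *\<^sub>R D x = m *\<^sub>R D y"
      by (rule injD[OF J(2)])
    then show "x = y"
      using assms injD[OF D(2)] by simp
  qed
  ultimately show "\<exists>E. ((\<lambda>(s, v). ?\<phi> (cis s, v)) has_derivative E) (at (t, w) within UNIV \<times> D2) \<and> inj E"
    by (auto simp: case_prod_unfold)
qed

lemma figure_eight_knot_scaled:
  assumes "m > 0"
  shows "figure_eight_knot (scaled_figure_eight m)"
proof -
  \<comment> \<open>The factor is written as the isotopy gives it at time 1; it equals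
    \<open>1 / m\<close> and undoes the scaling.\<close>
  have "dilation (1 + 1 * (1 / m - 1)) (scaled_figure_eight m z) = standard_figure_eight z" for z
    using assms
    by (simp add: scaled_figure_eight_def dilation_inv_stereographic standard_figure_eight_def
        figure_eight_tube_def)
  then have "takes_knot (\<lambda>(x, t). dilation (1 + t * (1 / m - 1)) x) (scaled_figure_eight m) standard_figure_eight"
    by (simp add: takes_knot_def image_image)
  then show ?thesis
    unfolding figure_eight_knot_def ambient_isotopic_def
    using ambient_isotopy_dilation[of "1 / m"] assms
      closed_regular_neighborhood_imp_knot(1)[OF closed_regular_neighborhood_figure_eight] by auto
qed

section \<open>A solid torus around the trefoil\<close>

text \<open>The tori \<open>norm a = cos \<alpha>\<close>, \<open>norm b = sin \<alpha>\<close>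
  foliate the sphere off two circles, and the trefoil lies on the one with \<alpha> = pi/4. One disc
  coordinate varies \<alpha>, the other rotates \<open>b\<close>, so the tube stays in the sphere by
  construction.\<close>

definition trefoil_tube :: "complex \<times> complex \<Rightarrow> complex \<times> complex" where
  "trefoil_tube p = (of_real (cos (pi / 4 + Re (snd p) / 100)) * fst p ^ 2,
     of_real (sin (pi / 4 + Re (snd p) / 100)) * fst p ^ 3 * cis (Im (snd p) / 100))"

lemma trefoil_tube_angle:
  assumes "w \<in> D2"
  shows "pi / 4 + Re w / 100 > 0" "pi / 4 + Re w / 100 < pi / 2"
  using abs_Re_Im_D2[OF assms] pi_gt3 by linarith+

text \<open>The modulus of the first coordinate determines the torus, and then its square leaves
  \<open>z\<close> up to sign. A sign change would negate \<open>z ^ 3\<close>, which rotations by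
  at most 1/100 cannot compensate.\<close>

lemma inj_on_trefoil_tube: "inj_on trefoil_tube (S1 \<times> D2)"
proof (rule inj_onI, clarify)
  fix z w z' w'
  assume mem: "z \<in> S1" "w \<in> D2" "z' \<in> S1" "w' \<in> D2"
    and eq: "trefoil_tube (z, w) = trefoil_tube (z', w')"
  define a where "a = pi / 4 + Re w / 100"
  define a' where "a' = pi / 4 + Re w' / 100"
  have a: "0 < a" "a < pi / 2" "0 < a'" "a' < pi / 2"
    using trefoil_tube_angle mem by (auto simp: a_def a'_def)
  then have pos: "cos a > 0" "cos a' > 0" "sin a > 0" "sin a' > 0"
    by (auto intro: cos_gt_zero_pi sin_gt_zero)
  have nz: "norm z = 1" "norm z' = 1"
    using mem by (auto simp: mem_sphere_0)
  then have z0: "z \<noteq> 0" "z' \<noteq> 0" by auto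
  have eq1: "of_real (cos a) * z ^ 2 = of_real (cos a') * z' ^ 2"
    and eq2: "of_real (sin a) * z ^ 3 * cis (Im w / 100) = of_real (sin a') * z' ^ 3 * cis (Im w' / 100)"
    using eq by (auto simp: trefoil_tube_def a_def a'_def)
  have "norm (of_real (cos a) * z ^ 2) = norm (of_real (cos a') * z' ^ 2)"
    using eq1 by simp
  then have "cos a = cos a'"
    using pos nz by (simp add: norm_mult norm_power)
  then have aa: "a = a'"
    by (rule cos_inj_pi[rotated 4]) (use a in auto)
  then have z2: "z ^ 2 = z' ^ 2"
    using eq1 pos by simp
  have z3: "z ^ 3 * cis (Im w / 100) = z' ^ 3 * cis (Im w' / 100)"
    using eq2 pos unfolding aa mult.assoc by simp
  have small: "\<bar>Im v / 100\<bar> < pi / 2" if "v \<in> D2" for v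
    using abs_Re_Im_D2[OF that] pi_gt3 by simp
  have "z \<noteq> - z'"
  proof
    assume "z = - z'"
    then have "z' ^ 3 * - cis (Im w / 100) = z' ^ 3 * cis (Im w' / 100)"
      using z3 by simp
    then have "- cis (Im w / 100) = cis (Im w' / 100)"
      using z0 by (metis mult_cancel_left power_not_zero)
    then have "- cos (Im w / 100) = cos (Im w' / 100)"
      by (auto simp: complex_eq_iff)
    then show False
      using cos_gt_zero_pi[of "Im w / 100"] cos_gt_zero_pi[of "Im w' / 100"]
        small[OF mem(2)] small[OF mem(4)] by (auto simp: abs_less_iff)
  qed
  then have zz: "z = z'"
    using z2 by (simp add: power2_eq_iff)
  then have "cis (Im w / 100) = cis (Im w' / 100)"
    using z3 z0 by simp
  then have "sin (Im w / 100) = sin (Im w' / 100)"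
    by (auto simp: complex_eq_iff)
  then have "Im w / 100 = Im w' / 100"
    by (rule sin_inj_pi[rotated 4])
      (use small[OF mem(2)] small[OF mem(4)] in \<open>auto simp: abs_less_iff\<close>)
  then show "z = z' \<and> w = w'"
    using aa zz by (simp add: a_def a'_def complex_eq_iff)
qed

text \<open>Each complex coordinate splits into a radial and an angular part. Since
  \<open>sin a\<close> and \<open>cos a\<close> are positive, the first coordinate detects
  \<open>Re (snd h)\<close> and \<open>fst h\<close>, and the angular part of the second then
  detects \<open>Im (snd h)\<close>.\<close>

lemma has_derivative_trefoil_tube:
  assumes "w \<in> D2"
  shows "\<exists>D. ((\<lambda>(s, v). trefoil_tube (cis s, v)) has_derivative D) (at (t, w) within S) \<and> inj D"
proof -
  define a where "a = pi / 4 + Re w / 100"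
  have a: "0 < a" "a < pi / 2"
    using trefoil_tube_angle[OF assms] by (auto simp: a_def)
  then have pos: "cos a > 0" "sin a > 0"
    by (auto intro: cos_gt_zero_pi sin_gt_zero)
  define b where "b = 3 * t + Im w / 100"
  let ?D = "\<lambda>h :: real \<times> complex.
    (of_real (- sin a * Re (snd h) / 100) * cis (2 * t) + of_real (2 * cos a * fst h) * (\<i> * cis (2 * t)),
     of_real (cos a * Re (snd h) / 100) * cis b + of_real (sin a * (3 * fst h + Im (snd h) / 100)) * (\<i> * cis b))"
  have eq: "(\<lambda>(s, v). trefoil_tube (cis s, v)) =
     (\<lambda>p. (of_real (cos (pi / 4 + Re (snd p) / 100)) * cis (2 * fst p),
          of_real (sin (pi / 4 + Re (snd p) / 100)) * cis (3 * fst p + Im (snd p) / 100)))"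
    by (auto simp: trefoil_tube_def Complex.DeMoivre cis_mult)
  have "((\<lambda>(s, v). trefoil_tube (cis s, v)) has_derivative ?D) (at (t, w) within S)"
    unfolding eq
    by (rule derivative_eq_intros refl | simp)+
      (auto simp: fun_eq_iff a_def b_def scaleR_conv_of_real algebra_simps)
  moreover have "inj ?D"
  proof -
    have "linear ?D"
      using calculation has_derivative_linear by blast
    moreover have "h = 0" if "?D h = 0" for h
    proof -
      have split: "x = 0 \<and> y = 0" if "of_real x * cis c + of_real y * (\<i> * cis c) = 0" for x y c
      proof -
        have "(of_real x + of_real y * \<i>) * cis c = 0"
          using that by (simp add: algebra_simps)
        then have "of_real x + of_real y * \<i> = 0"
          by (metis mult_eq_0_iff cis_neq_zero)
        then show ?thesis
          by (simp add: complex_eq_iff)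
      qed
      have "- sin a * Re (snd h) / 100 = 0 \<and> 2 * cos a * fst h = 0"
        using that by (intro split[of _ "2 * t"]) (simp add: prod_eq_iff)
      then have f: "Re (snd h) = 0" "fst h = 0"
        using pos by auto
      have "cos a * Re (snd h) / 100 = 0 \<and> sin a * (3 * fst h + Im (snd h) / 100) = 0"
        using that by (intro split[of _ b]) (simp add: prod_eq_iff)
      then have "Im (snd h) = 0"
        using pos f by auto
      with f show ?thesis by (simp add: prod_eq_iff complex_eq_iff)
    qed
    ultimately show ?thesis
      using linear_injective_0 by blast
  qed
  ultimately show ?thesis by blast
qed

lemma closed_regular_neighborhood_trefoil:
  "closed_regular_neighborhood standard_trefoil (trefoil_tube ` (S1 \<times> D2))"
  unfolding closed_regular_neighborhood_def
proof (rule exI[of _ trefoil_tube], intro conjI allI ballI)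
  \<comment> \<open>Real cosine and sine are reduced to the complex exponential, whose closure under
    \<open>Ck_on\<close> is \<open>Ck_on_exp\<close>.\<close>
  have "cos x = Re (exp (\<i> * of_real x))" "sin x = Im (exp (\<i> * of_real x))" for x
    by (simp_all flip: cis_conv_exp)
  then have "Ck_on k UNIV trefoil_tube" for k
    unfolding trefoil_tube_def cis_conv_exp
    by (simp only:) (intro Ck_on_intros open_UNIV; simp)
  then show "smooth_on (S1 \<times> D2) trefoil_tube"
    by (intro smooth_onI[OF open_UNIV]) auto
  show "inj_on trefoil_tube (S1 \<times> D2)"
    by (rule inj_on_trefoil_tube)
  show "trefoil_tube (z, 0) = standard_trefoil z" for z
    by (simp add: trefoil_tube_def standard_trefoil_def cos_45 sin_45 complex_eq_iff real_div_sqrt field_simps)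
  show "trefoil_tube ` (S1 \<times> D2) = trefoil_tube ` (S1 \<times> D2)" ..
  show "trefoil_tube ` (S1 \<times> D2) \<subseteq> S3"
  proof (rule image_subsetI)
    fix p :: "complex \<times> complex" assume "p \<in> S1 \<times> D2"
    then have "norm (fst p) = 1" by (auto simp: mem_sphere_0)
    then have "(norm (fst (trefoil_tube p)))\<^sup>2 + (norm (snd (trefoil_tube p)))\<^sup>2 = 1"
      by (simp add: trefoil_tube_def norm_mult norm_power)
    then show "trefoil_tube p \<in> S3"
      unfolding mem_S3 cmod_power2[of "snd _"] by simp
  qed
  fix t and w :: complex assume "w \<in> D2"
  then show "\<exists>D. ((\<lambda>(s, v). trefoil_tube (cis s, v)) has_derivative D) (at (t, w) within UNIV \<times> D2) \<and> inj D"
    by (rule has_derivative_trefoil_tube)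
qed

section \<open>Separation of the two knots from the trefoil\<close>

lemma norm_fst_inv_stereographic:
  "norm (fst (inv_stereographic p)) = 2 * norm (fst p) / ((norm (fst p))\<^sup>2 + (snd p)\<^sup>2 + 1)"
proof -
  have "\<bar>(norm (fst p))\<^sup>2 + (snd p)\<^sup>2 + 1\<bar> = (norm (fst p))\<^sup>2 + (snd p)\<^sup>2 + 1"
    by (simp add: add_nonneg_nonneg)
  then show ?thesis
    unfolding inv_stereographic_def Let_def fst_conv norm_divide norm_mult norm_of_real by simp
qed

lemma figure_eight_tube_bounds:
  assumes "z \<in> S1" "w \<in> D2"
  defines "r \<equiv> norm (fst (figure_eight_tube (z, w)))"
    and "h \<equiv> snd (figure_eight_tube (z, w))"
  shows "0 < r" "r \<le> 31 / 10" "\<bar>h\<bar> \<le> 11 / 10" "(r - 2)\<^sup>2 + h\<^sup>2 \<le> (27 / 20)\<^sup>2"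
proof -
  have nz: "norm z = 1" using assms(1) by (simp add: mem_sphere_0)
  have r: "r = 2 + Re (z ^ 2) + Re w / 10"
    using figure_eight_tube_radius_pos[OF assms(1,2)] nz
    by (simp add: r_def figure_eight_tube_def norm_mult norm_power del: of_real_add of_real_divide)
  have h: "h = Im (z ^ 4) + Im w / 10"
    by (simp add: h_def figure_eight_tube_def)
  show "0 < r"
    using figure_eight_tube_radius_pos[OF assms(1,2)] by (simp add: r)
  have "\<bar>Re (z ^ 2)\<bar> \<le> 1" "\<bar>Im (z ^ 4)\<bar> \<le> 1"
    using abs_Re_le_cmod[of "z ^ 2"] abs_Im_le_cmod[of "z ^ 4"] nz by (simp_all add: norm_power)
  then show "r \<le> 31 / 10" "\<bar>h\<bar> \<le> 11 / 10"
    using abs_Re_Im_D2[OF assms(2)] unfolding r h by linarith+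
  define p q where "p = Re (z ^ 2)" and "q = Im (z ^ 2)"
  have pq: "q\<^sup>2 = 1 - p\<^sup>2"
    using nz cmod_power2[of "z ^ 2"] by (simp add: p_def q_def norm_power)
  have "z ^ 4 = (z ^ 2) ^ 2" by simp
  then have z4: "Im (z ^ 4) = 2 * p * q"
    by (simp only: p_def q_def Im_power2)
  have "(norm (Complex p (2 * p * q)))\<^sup>2 = p\<^sup>2 + 4 * p\<^sup>2 * q\<^sup>2"
    by (simp add: cmod_power2 power_mult_distrib)
  \<comment> \<open>Completing the square in \<open>p\<^sup>2\<close>: the core stays within 5/4 of
    the circle of radius 2, and the disc of radius 1/10 makes this 27/20.\<close>
  also have "\<dots> = (5 / 4)\<^sup>2 - (2 * p\<^sup>2 - 5 / 4)\<^sup>2"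
    unfolding pq by (simp add: power2_eq_square algebra_simps)
  also have "\<dots> \<le> (5 / 4)\<^sup>2"
    by simp
  finally have "norm (Complex p (2 * p * q)) \<le> 5 / 4"
    by (rule power2_le_imp_le) simp
  moreover have "norm (w / 10) \<le> 1 / 10"
    using assms(2) by (simp add: mem_cball_0 norm_divide)
  ultimately have "norm (Complex p (2 * p * q) + w / 10) \<le> 27 / 20"
    using norm_triangle_ineq[of "Complex p (2 * p * q)" "w / 10"] by linarith
  then have "(norm (Complex p (2 * p * q) + w / 10))\<^sup>2 \<le> (27 / 20)\<^sup>2"
    by (rule power_mono) simp
  also have "(norm (Complex p (2 * p * q) + w / 10))\<^sup>2 = (r - 2)\<^sup>2 + h\<^sup>2"
    unfolding cmod_power2 r h z4 by (simp add: p_def)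
  finally show "(r - 2)\<^sup>2 + h\<^sup>2 \<le> (27 / 20)\<^sup>2" .
qed

text \<open>Both \<open>norm (fst x)\<close> and the modulus of \<open>Re (snd x)\<close> are at
  most 1/10, so \<open>(Im (snd x))\<^sup>2\<close> is at least 98/100 and outweighs the other terms
  of \<open>Re (milnor x)\<close>, which total at most 12/1000.\<close>

lemma small_figure_eight_nbhd:
  assumes "x \<in> figure_eight_nbhd (1 / 100)"
  shows "norm (fst x) \<le> 1 / 10" "Re (milnor x) > 0"
proof -
  obtain z w where zw: "z \<in> S1" "w \<in> D2"
    and x: "x = inv_stereographic ((1 / 100) *\<^sub>R figure_eight_tube (z, w))"
    using assms by (auto simp: figure_eight_nbhd_def)
  define p where "p = (1 / 100) *\<^sub>R figure_eight_tube (z, w)"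
  have xp: "x = inv_stereographic p" by (simp add: x p_def)
  have c: "norm (fst p) \<le> 1 / 20" and h: "\<bar>snd p\<bar> \<le> 1 / 20"
    using figure_eight_tube_bounds[OF zw] by (simp_all add: p_def)
  define d where "d = (norm (fst p))\<^sup>2 + (snd p)\<^sup>2 + 1"
  have d: "d \<ge> 1" by (simp add: d_def)
  have le: "y / d \<le> y" if "y \<ge> 0" for y
    using d that by (simp add: divide_le_eq mult_le_cancel_left1)
  have "norm (fst x) \<le> 2 * norm (fst p)"
    unfolding xp norm_fst_inv_stereographic d_def[symmetric] by (rule le) simp
  then show a: "norm (fst x) \<le> 1 / 10"
    using c by simp
  have "\<bar>Re (snd x)\<bar> = (2 * \<bar>snd p\<bar>) / d"
    using d by (simp add: xp inv_stereographic_def Let_def d_def[symmetric] abs_mult)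
  also have "\<dots> \<le> 2 * \<bar>snd p\<bar>"
    by (rule le) simp
  finally have b: "\<bar>Re (snd x)\<bar> \<le> 1 / 10"
    using h by simp
  have a2: "(norm (fst x))\<^sup>2 \<le> (1 / 10)\<^sup>2" and a3: "norm (fst x) ^ 3 \<le> (1 / 10) ^ 3"
    using a by (auto intro!: power_mono)
  have b2: "(Re (snd x))\<^sup>2 \<le> (1 / 10)\<^sup>2"
    using b abs_le_square_iff[of "Re (snd x)" "1 / 10"] by simp
  have "sqrt 2 \<le> 2"
    by (rule real_le_lsqrt) auto
  then have "sqrt 2 * norm (fst x) ^ 3 \<le> 2 * (1 / 10) ^ 3"
    using a3 by (intro mult_mono) auto
  moreover have "\<bar>Re (of_real (sqrt 2) * fst x ^ 3)\<bar> \<le> sqrt 2 * norm (fst x) ^ 3"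
    using abs_Re_le_cmod[of "of_real (sqrt 2) * fst x ^ 3"] by (simp add: norm_mult norm_power)
  moreover have "(norm (fst x))\<^sup>2 + (Re (snd x))\<^sup>2 + (Im (snd x))\<^sup>2 = 1"
    using inv_stereographic_in_S3[of p] by (simp add: xp mem_S3)
  moreover have "Re (milnor x) = Re (of_real (sqrt 2) * fst x ^ 3) - ((Re (snd x))\<^sup>2 - (Im (snd x))\<^sup>2)"
    unfolding milnor_def by (simp add: Re_power2)
  ultimately show "Re (milnor x) > 0"
    using a2 b2 by (simp add: power2_eq_square power3_eq_cube abs_le_iff)
qed

lemma large_figure_eight_nbhd:
  assumes "x \<in> figure_eight_nbhd (1 / sqrt 2)"
  shows "sqrt 2 * norm (fst x) > 101 / 100"
proof -
  obtain z w where zw: "z \<in> S1" "w \<in> D2"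
    and x: "x = inv_stereographic ((1 / sqrt 2) *\<^sub>R figure_eight_tube (z, w))"
    using assms by (auto simp: figure_eight_nbhd_def)
  define r where "r = norm (fst (figure_eight_tube (z, w)))"
  define h where "h = snd (figure_eight_tube (z, w))"
  have r: "0 < r" "r \<le> 31 / 10" "(r - 2)\<^sup>2 + h\<^sup>2 \<le> (27 / 20)\<^sup>2"
    using figure_eight_tube_bounds[OF zw] by (simp_all add: r_def h_def)
  have pos: "r\<^sup>2 + h\<^sup>2 + 2 > 0" by (simp add: add_nonneg_pos)
  have "sqrt 2 * norm (fst x) = 2 * r / (r\<^sup>2 / 2 + h\<^sup>2 / 2 + 1)"
    unfolding x norm_fst_inv_stereographic
    by (simp add: power_mult_distrib power_divide flip: r_def h_def)
  also have "\<dots> = 4 * r / (r\<^sup>2 + h\<^sup>2 + 2)"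
    using pos by (simp add: field_simps)
  \<comment> \<open>The bound on \<open>(r - 2)\<^sup>2 + h\<^sup>2\<close> makes the denominator at
    most \<open>4 * r - 71 / 400\<close>; for \<open>r\<close> up to 31/10 this slack suffices for
    101/100 in place of 1.\<close>
  also have "\<dots> > 101 / 100"
    using pos r by (subst pos_less_divide_eq) (simp_all add: power2_eq_square algebra_simps)
  finally show ?thesis .
qed

text \<open>Since \<open>sqrt 2 * cos (pi / 4 + y) = cos y - sin y\<close>, a shift by at most 1/100
  raises the value 1 on the trefoil by at most 1/100. This is the origin of the threshold
  101/100.\<close>

lemma trefoil_tube_bounds:
  assumes "x \<in> trefoil_tube ` (S1 \<times> D2)"
  shows "sqrt 2 * norm (fst x) \<le> 101 / 100" "1 / 10 < norm (fst x)"
proof -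
  obtain z w where zw: "z \<in> S1" "w \<in> D2" and x: "x = trefoil_tube (z, w)"
    using assms by auto
  define y where "y = Re w / 100"
  have y: "\<bar>y\<bar> \<le> 1 / 100"
    using abs_Re_Im_D2[OF zw(2)] by (simp add: y_def)
  have s: "\<bar>sin y\<bar> \<le> 1 / 100"
    using abs_sin_x_le_abs_x[of y] y by linarith
  have "\<bar>sin (y / 2)\<bar> \<le> 1 / 100"
    using abs_sin_x_le_abs_x[of "y / 2"] y by simp
  then have "(sin (y / 2))\<^sup>2 \<le> (1 / 100)\<^sup>2"
    using abs_le_square_iff[of "sin (y / 2)" "1 / 100"] by simp
  moreover have "cos y = 1 - 2 * (sin (y / 2))\<^sup>2"
    using cos_double_sin[of "y / 2"] by simp
  ultimately have c: "cos y \<ge> 9 / 10" "cos y \<le> 1"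
    by (auto simp: power2_eq_square)
  have "sqrt 2 * cos (pi / 4 + y) = cos y - sin y"
    by (simp add: cos_add cos_45 sin_45 algebra_simps)
  moreover have "cos (pi / 4 + y) > 0"
    using trefoil_tube_angle[OF zw(2)] by (intro cos_gt_zero_pi) (auto simp: y_def)
  then have "norm (fst x) = cos (pi / 4 + y)"
    using zw(1) by (simp add: x trefoil_tube_def norm_mult norm_power y_def mem_sphere_0)
  ultimately have n: "sqrt 2 * norm (fst x) = cos y - sin y"
    by simp
  then show "sqrt 2 * norm (fst x) \<le> 101 / 100"
    using c s by linarith
  have "sqrt 2 \<le> 2"
    by (rule real_le_lsqrt) auto
  then have "sqrt 2 * norm (fst x) \<le> 2 * norm (fst x)"
    by (rule mult_right_mono) simp
  then show "1 / 10 < norm (fst x)"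
    using n c s by linarith
qed

lemma scaled_figure_eight_subset:
  "m > 0 \<Longrightarrow> scaled_figure_eight m ` S1 \<subseteq> figure_eight_nbhd m"
  by (rule closed_regular_neighborhood_imp_knot(2)[OF closed_regular_neighborhood_figure_eight])

section \<open>Winding of the polynomial along the two knots\<close>

lemma milnor_log_small_figure_eight: "milnor_log (scaled_figure_eight (1 / 100) ` S1)"
proof -
  have pos: "Re (milnor x) > 0" if "x \<in> scaled_figure_eight (1 / 100) ` S1" for x
    by (rule small_figure_eight_nbhd(2)[OF subsetD[OF scaled_figure_eight_subset that]]) simp
  show ?thesis
    unfolding milnor_log_def
  proof (intro exI conjI ballI)
    show "continuous_on (scaled_figure_eight (1 / 100) ` S1) (\<lambda>x. Ln (milnor x))"
      using pos by (intro continuous_intros) (fastforce simp: complex_nonpos_Reals_iff)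
    fix x assume "x \<in> scaled_figure_eight (1 / 100) ` S1"
    then have "milnor x \<noteq> 0" using pos[of x] by auto
    then show "milnor x = exp (Ln (milnor x))" by simp
  qed
qed

text \<open>Here \<open>milnor\<close> is \<open>sqrt 2 * a ^ 3 * (1 - q)\<close> with
  \<open>norm q < 1\<close>, so the last factor has a principal logarithm, and the direction of
  \<open>a\<close> is \<open>z ^ 3\<close>. A logarithm of \<open>milnor\<close> would therefore
  give one of \<open>z ^ 9\<close> on the circle.\<close>

lemma not_milnor_log_large_figure_eight: "\<not> milnor_log (scaled_figure_eight (1 / sqrt 2) ` S1)"
proof
  let ?K = "scaled_figure_eight (1 / sqrt 2)"
  assume "milnor_log (?K ` S1)"
  then obtain g where g: "continuous_on (?K ` S1) g" "\<And>z. z \<in> S1 \<Longrightarrow> milnor (?K z) = exp (g (?K z))"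
    by (auto simp: milnor_log_def)
  have "knot ?K"
    by (rule closed_regular_neighborhood_imp_knot(1)[OF closed_regular_neighborhood_figure_eight]) simp
  then have cont: "continuous_on S1 ?K" and S3: "?K ` S1 \<subseteq> S3"
    by (auto simp: knot_def smooth_on_imp_continuous_on)
  define a b where "a z = fst (?K z)" and "b z = snd (?K z)" for z
  define q where "q z = b z ^ 2 / (of_real (sqrt 2) * a z ^ 3)" for z
  have ca: "continuous_on S1 a" and cb: "continuous_on S1 b"
    unfolding a_def b_def by (intro continuous_intros cont)+
  have large: "sqrt 2 * norm (a z) > 1" if "z \<in> S1" for z
  proof -
    have "?K z \<in> figure_eight_nbhd (1 / sqrt 2)"
      using scaled_figure_eight_subset[of "1 / sqrt 2"] that by auto
    then show ?thesis
      using large_figure_eight_nbhd[of "?K z"] by (simp add: a_def)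
  qed
  then have a0: "a z \<noteq> 0" if "z \<in> S1" for z
    using that by fastforce
  have q: "norm (q z) < 1" if "z \<in> S1" for z
  proof -
    let ?n = "norm (a z)"
    \<comment> \<open>More than half of the squared norm of the unit vector belongs to
      \<open>a\<close>, hence \<open>(norm b)\<^sup>2 < ?n\<^sup>2\<close>, and
      \<open>?n\<^sup>2\<close> is at most \<open>sqrt 2 * ?n ^ 3\<close>.\<close>
    have "1\<^sup>2 < (sqrt 2 * ?n)\<^sup>2"
      using large[OF that] by (intro power_strict_mono) auto
    then have n: "1 < 2 * ?n\<^sup>2"
      by (simp add: power_mult_distrib)
    have "?n\<^sup>2 * 1 \<le> ?n\<^sup>2 * (sqrt 2 * ?n)"
      using large[OF that] by (intro mult_left_mono) auto
    then have "?n\<^sup>2 \<le> sqrt 2 * ?n ^ 3"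
      by (simp add: power2_eq_square power3_eq_cube algebra_simps)
    moreover have "?n\<^sup>2 + (norm (b z))\<^sup>2 = 1"
      using S3 that unfolding a_def b_def cmod_power2[of "snd _"] by (auto simp: mem_S3 image_subset_iff)
    ultimately have "(norm (b z))\<^sup>2 < sqrt 2 * ?n ^ 3"
      using n by linarith
    then show ?thesis
      using a0[OF that] by (simp add: q_def norm_divide norm_mult norm_power divide_less_eq)
  qed
  then have Re_q: "Re (1 - q z) > 0" if "z \<in> S1" for z
    using complex_Re_le_cmod[of "q z"] that by fastforce
  \<comment> \<open>Removing the logarithms of \<open>1 - q\<close> and of the positive modulus
    leaves a logarithm of the phase of \<open>a ^ 3\<close>.\<close>
  define G where "G z = g (?K z) - Ln (1 - q z) - of_real (ln (sqrt 2 * norm (a z) ^ 3))" for z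
  have "continuous_on S1 q"
    unfolding q_def using a0 by (intro continuous_intros ca cb) auto
  then have "continuous_on S1 G"
    unfolding G_def using a0 Re_q
    by (intro continuous_intros continuous_on_compose2[OF g(1) cont] ca)
      (fastforce simp: complex_nonpos_Reals_iff)+
  then obtain z where z: "z \<in> S1" "z ^ 9 \<noteq> exp (G z)"
    using no_continuous_log_power_circle[of 9 G] by auto
  have "exp (Ln (1 - q z)) = 1 - q z"
    using Re_q[OF z(1)] by (intro exp_Ln) force
  moreover have "exp (complex_of_real (ln (sqrt 2 * norm (a z) ^ 3))) = of_real (sqrt 2 * norm (a z) ^ 3)"
    using a0[OF z(1)] by (simp add: exp_of_real del: of_real_mult)
  ultimately have "exp (G z) = milnor (?K z) / (1 - q z) / of_real (sqrt 2 * norm (a z) ^ 3)"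
    by (simp add: G_def exp_diff g(2)[OF z(1)])
  also have "milnor (?K z) = of_real (sqrt 2) * a z ^ 3 * (1 - q z)"
    using a0[OF z(1)] by (simp add: milnor_def a_def b_def q_def right_diff_distrib)
  finally have "exp (G z) = (a z / of_real (norm (a z))) ^ 3"
    using Re_q[OF z(1)] a0[OF z(1)] by (auto simp: power_divide)
  moreover obtain k where k: "k > 0" "a z = of_real k * z ^ 3"
  proof -
    define p where "p = (1 / sqrt 2) *\<^sub>R figure_eight_tube (z, 0)"
    define r where "r = 2 + Re (z ^ 2) + Re 0 / 10"
    have r: "r > 0"
      unfolding r_def by (rule figure_eight_tube_radius_pos[OF z(1)]) simp
    have d: "(norm (fst p))\<^sup>2 + (snd p)\<^sup>2 + 1 > 0"
      by (simp add: add_nonneg_pos)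
    have a: "a z = of_real (2 * (r / sqrt 2) / ((norm (fst p))\<^sup>2 + (snd p)\<^sup>2 + 1)) * z ^ 3"
    proof -
      have "fst p = of_real (r / sqrt 2) * z ^ 3"
        by (simp add: p_def figure_eight_tube_def r_def scaleR_conv_of_real)
      then have "2 * fst p / of_real e = of_real (2 * (r / sqrt 2) / e) * z ^ 3" for e
        by simp
      then show ?thesis
        unfolding a_def scaled_figure_eight_def p_def[symmetric] inv_stereographic_def Let_def fst_conv .
    qed
    show thesis
      by (rule that[OF _ a]) (use r d in simp)
  qed
  moreover have "norm z = 1"
    using z(1) by (simp add: mem_sphere_0)
  ultimately have "exp (G z) = (z ^ 3) ^ 3"
    by (simp add: norm_mult norm_power)
  then show False
    using z(2) by simp
qed

theorem proposition5:
  shows "\<exists>K1 K2 T.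
    figure_eight_knot K1 \<and> figure_eight_knot K2 \<and> trefoil_knot T \<and>
    (\<exists>V1 V2 VT.
       closed_regular_neighborhood K1 V1 \<and> closed_regular_neighborhood K2 V2 \<and>
       closed_regular_neighborhood T VT \<and>
       T ` S1 \<subseteq> closure (S3 - (V1 \<union> V2)) \<and> VT \<inter> (K1 ` S1 \<union> K2 ` S1) = {}) \<and>
    (\<forall>VT. closed_regular_neighborhood T VT \<and> VT \<inter> (K1 ` S1 \<union> K2 ` S1) = {} \<longrightarrow>
       \<not> (\<exists>H. ambient_isotopy H \<and> takes_knot H K1 K2 \<and>
              (\<forall>t\<in>{0..1}. \<forall>x\<in>VT. H (x, t) = x)))"
proof -
  let ?K1 = "scaled_figure_eight (1 / 100)" and ?K2 = "scaled_figure_eight (1 / sqrt 2)"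
  let ?V1 = "figure_eight_nbhd (1 / 100)" and ?V2 = "figure_eight_nbhd (1 / sqrt 2)"
  let ?T = standard_trefoil and ?VT = "trefoil_tube ` (S1 \<times> D2)"
  have nbhd: "closed_regular_neighborhood ?K1 ?V1" "closed_regular_neighborhood ?K2 ?V2"
    by (auto intro: closed_regular_neighborhood_figure_eight)
  note T = closed_regular_neighborhood_trefoil
  have sub: "?K1 ` S1 \<subseteq> ?V1" "?K2 ` S1 \<subseteq> ?V2" "?T ` S1 \<subseteq> ?VT"
    using nbhd T closed_regular_neighborhood_imp_knot(2) by blast+
  have knots: "knot ?T" "knot ?K1"
    using nbhd T closed_regular_neighborhood_imp_knot(1) by blast+
  then have S3: "?T ` S1 \<subseteq> S3" "?K1 ` S1 \<subseteq> S3"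
    by (auto simp: knot_def)
  \<comment> \<open>The modulus of the first coordinate separates the sets: at most 1/10 on
    \<open>?V1\<close>, above 1/10 and at most 101 / (100 sqrt 2) on \<open>?VT\<close>, larger
    still on \<open>?V2\<close>.\<close>
  have "x \<notin> ?V1" "x \<notin> ?V2" if "x \<in> ?VT" for x
    using small_figure_eight_nbhd(1)[of x] large_figure_eight_nbhd[of x] trefoil_tube_bounds[OF that]
    by (meson leD)+
  then have disj: "?VT \<inter> (?V1 \<union> ?V2) = {}"
    by blast
  have trefoil: "trefoil_knot ?T"
    using knots by (simp add: trefoil_knot_def ambient_isotopic_refl)
  have "?T ` S1 \<subseteq> S3 - (?V1 \<union> ?V2)"
    using sub disj S3 by blast
  then have closure: "?T ` S1 \<subseteq> closure (S3 - (?V1 \<union> ?V2))"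
    using closure_subset by blast
  have avoid: "?VT \<inter> (?K1 ` S1 \<union> ?K2 ` S1) = {}"
    using sub disj by blast
  have none: "\<not> (\<exists>H. ambient_isotopy H \<and> takes_knot H ?K1 ?K2 \<and> (\<forall>t\<in>{0..1}. \<forall>x\<in>VT. H (x, t) = x))"
    if VT: "closed_regular_neighborhood ?T VT" for VT
  proof
    assume "\<exists>H. ambient_isotopy H \<and> takes_knot H ?K1 ?K2 \<and> (\<forall>t\<in>{0..1}. \<forall>x\<in>VT. H (x, t) = x)"
    then obtain H where H: "ambient_isotopy H" "takes_knot H ?K1 ?K2"
      "\<And>t x. t \<in> {0..1} \<Longrightarrow> x \<in> VT \<Longrightarrow> H (x, t) = x"
      by blast
    \<comment> \<open>An arbitrary tube \<open>VT\<close> contains its core, so \<open>H\<close>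
      fixes the trefoil pointwise.\<close>
    have TVT: "?T ` S1 \<subseteq> VT"
      by (rule closed_regular_neighborhood_imp_knot(2)[OF VT])
    have "milnor_log ((\<lambda>x. H (x, 1)) ` ?K1 ` S1)"
    proof (rule milnor_log_ambient_isotopy[OF H(1) _ S3(2) _ S3(1) milnor_log_small_figure_eight])
      show "H (x, t) = x" if "t \<in> {0..1}" "x \<in> ?T ` S1" for t x
        using H(3) that TVT by (meson subsetD)
      show "?K1 ` S1 \<inter> ?T ` S1 = {}"
        using avoid sub by blast
    qed
    then show False
      using H(2) not_milnor_log_large_figure_eight by (simp add: takes_knot_def)
  qed
  show ?thesis
  proof (rule exI[of _ ?K1], rule exI[of _ ?K2], rule exI[of _ ?T], intro conjI)
    show "figure_eight_knot ?K1" "figure_eight_knot ?K2"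
      by (rule figure_eight_knot_scaled; simp)+
    show "trefoil_knot ?T"
      by (rule trefoil)
    show "\<exists>V1 V2 VT. closed_regular_neighborhood ?K1 V1 \<and> closed_regular_neighborhood ?K2 V2 \<and>
       closed_regular_neighborhood ?T VT \<and>
       ?T ` S1 \<subseteq> closure (S3 - (V1 \<union> V2)) \<and> VT \<inter> (?K1 ` S1 \<union> ?K2 ` S1) = {}"
      by (rule exI[of _ ?V1], rule exI[of _ ?V2], rule exI[of _ ?VT],
          intro conjI nbhd T closure avoid)
    show "\<forall>VT. closed_regular_neighborhood ?T VT \<and> VT \<inter> (?K1 ` S1 \<union> ?K2 ` S1) = {} \<longrightarrow>
       \<not> (\<exists>H. ambient_isotopy H \<and> takes_knot H ?K1 ?K2 \<and>
              (\<forall>t\<in>{0..1}. \<forall>x\<in>VT. H (x, t) = x))"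
      by (intro allI impI none) (erule conjunct1)
  qed
qed

end
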